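(* Let $N\ge2$, $p>1$, $\theta,l\in\mathbb{R}$, $R>0$, and let $v$ be a solution of $-\mathrm{div}(|x|^\theta\nabla v)=|x|^l|v|^{p-1}v$ in $B_R\setminus\{0\}$. Define $$z(y)=v(x),\qquad y=\frac{x}{|x|^2},$$ for $y\in\mathbb{R}^N\setminus\overline{B_{1/R}}$, and put $\tilde\theta=4-2N-\theta$, $\tilde l=-2N-l$. Then $v$ is stable in $B_R\setminus\{0\}$ if and only if $z$ is a stable solution of $$-\mathrm{div}(|y|^{\tilde\theta}\nabla z)=|y|^{\tilde l}|z|^{p-1}z\quad\text{in }\mathbb{R}^N\setminus\overline{B_{1/R}}.$$
   Context: $B_r$ is the open ball in $\mathbb{R}^N$ centered at $0$ with radius $r$. $H^{1,\theta}(\Omega)$ is the space of functions $\varphi$ with $|x|^{\theta/2}\varphi,\ |x|^{\theta/2}|\nabla\varphi|\in L^2(\Omega)$; $H^{1,\theta}_{loc}(\Omega)$ is the corresponding local space, and $H^{1,\theta}_c(\Omega)$ the subspace of functions in $H^{1,\theta}(\Omega)$ with compact support in $\Omega$. (If $0\notin\Omega$, $H^{1,\theta}_{loc}(\Omega)=H^1_{loc}(\Omega)$ and $H^{1,\theta}_c(\Omega)=H^1_c(\Omega)$.) For any exponents $\mu,\lambda\in\mathbb{R}$, a function $v$ is a solution of $-\mathrm{div}(|x|^\mu\nabla v)=|x|^\lambda|v|^{p-1}v$ in $\Omega$ if $v\in H^{1,\mu}_{loc}(\Omega)\cap L^\infty_{loc}(\Omega)$ and $\int_\Omega\big(|x|^\mu\nabla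 v\cdot\nabla\phi-|x|^\lambda|v|^{p-1}v\phi\big)dx=0$ for all $\phi\in H^{1,\mu}_c(\Omega)\cap L^\infty_{loc}(\Omega)$. It is stable in $\Omega$ if $\int_\Omega\big(|x|^\mu|\nabla\psi|^2-p|x|^\lambda|v|^{p-1}\psi^2\big)dx\ge0$ for all $\psi\in H^{1,\mu}_c(\Omega)\cap L^\infty_{loc}(\Omega)$. *)

theory Defs
  imports "HOL-Analysis.Analysis"
begin

text \<open>
  Functions on an open set \<Omega> are represented by total functions on the ambient space; every notion
  below depends only on their values on \<Omega>, and elements of the function spaces are individual
  functions rather than a.e.-equivalence classes. All integrals are Lebesgue integrals over \<Omega>.
\<close>

text \<open>For open \<open>\<Omega>\<close>: all partial derivatives up to order \<open>k\<close> exist and are continuous on \<open>\<Omega>\<close>.\<close>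

primrec Ck_on :: "nat \<Rightarrow> 'a::euclidean_space set \<Rightarrow> ('a \<Rightarrow> real) \<Rightarrow> bool" where
  "Ck_on 0 \<Omega> f \<longleftrightarrow> continuous_on \<Omega> f"
| "Ck_on (Suc k) \<Omega> f \<longleftrightarrow>
     f differentiable_on \<Omega> \<and> (\<forall>b\<in>Basis. Ck_on k \<Omega> (\<lambda>x. frechet_derivative f (at x) b))"

definition test_functions :: "'a::euclidean_space set \<Rightarrow> ('a \<Rightarrow> real) set" where
  "test_functions \<Omega> = {\<phi>. (\<forall>k. Ck_on k \<Omega> \<phi>) \<and>
     compact (closure {x. \<phi> x \<noteq> 0}) \<and> closure {x. \<phi> x \<noteq> 0} \<subseteq> \<Omega>}"

definition L1_loc :: "'a::euclidean_space set \<Rightarrow> ('a \<Rightarrow> 'b::euclidean_space) set" where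
  "L1_loc \<Omega> = {f. \<forall>K. compact K \<and> K \<subseteq> \<Omega> \<longrightarrow> f absolutely_integrable_on K}"

definition L2 :: "'a::euclidean_space set \<Rightarrow> ('a \<Rightarrow> real) set" where
  "L2 \<Omega> = {f. f \<in> borel_measurable (lebesgue_on \<Omega>) \<and> (\<lambda>x. (f x)\<^sup>2) absolutely_integrable_on \<Omega>}"

definition Linfty_loc :: "'a::euclidean_space set \<Rightarrow> ('a \<Rightarrow> real) set" where
  "Linfty_loc \<Omega> = {f. f \<in> borel_measurable (lebesgue_on \<Omega>) \<and>
     (\<forall>K. compact K \<and> K \<subseteq> \<Omega> \<longrightarrow> (\<exists>C. AE x in lebesgue. x \<in> K \<longrightarrow> \<bar>f x\<bar> \<le> C))}"

text \<open>\<open>g\<close> is the weak (distributional) gradient of \<open>u\<close> on \<open>\<Omega>\<close>; it is unique up to null sets.\<close>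

definition weak_gradient ::
    "'a::euclidean_space set \<Rightarrow> ('a \<Rightarrow> real) \<Rightarrow> ('a \<Rightarrow> 'a) \<Rightarrow> bool" where
  "weak_gradient \<Omega> u g \<longleftrightarrow> u \<in> L1_loc \<Omega> \<and> g \<in> L1_loc \<Omega> \<and>
     (\<forall>\<phi>\<in>test_functions \<Omega>. \<forall>b\<in>Basis.
        (LINT x:\<Omega>|lebesgue. u x * frechet_derivative \<phi> (at x) b) =
        - (LINT x:\<Omega>|lebesgue. (g x \<bullet> b) * \<phi> x))"

text \<open>The weighted Sobolev spaces \<open>H\<^sup>1\<^sup>,\<^sup>\<theta>(\<Omega>)\<close>, \<open>H\<^sup>1\<^sup>,\<^sup>\<theta>\<^sub>l\<^sub>o\<^sub>c(\<Omega>)\<close> and \<open>H\<^sup>1\<^sup>,\<^sup>\<theta>\<^sub>c(\<Omega>)\<close>.\<close>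

definition H1 :: "real \<Rightarrow> 'a::euclidean_space set \<Rightarrow> ('a \<Rightarrow> real) set" where
  "H1 \<theta> \<Omega> = {u. \<exists>g. weak_gradient \<Omega> u g \<and>
     (\<lambda>x. norm x powr (\<theta> / 2) * u x) \<in> L2 \<Omega> \<and>
     (\<lambda>x. norm x powr (\<theta> / 2) * norm (g x)) \<in> L2 \<Omega>}"

definition H1_loc :: "real \<Rightarrow> 'a::euclidean_space set \<Rightarrow> ('a \<Rightarrow> real) set" where
  "H1_loc \<theta> \<Omega> = {u. \<exists>g. weak_gradient \<Omega> u g \<and>
     (\<forall>K. compact K \<and> K \<subseteq> \<Omega> \<longrightarrow>
        (\<lambda>x. norm x powr (\<theta> / 2) * u x) \<in> L2 K \<and>
        (\<lambda>x. norm x powr (\<theta> / 2) * norm (g x)) \<in> L2 K)}"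

definition H1_c :: "real \<Rightarrow> 'a::euclidean_space set \<Rightarrow> ('a \<Rightarrow> real) set" where
  "H1_c \<theta> \<Omega> = {u \<in> H1 \<theta> \<Omega>.
     \<exists>K. compact K \<and> K \<subseteq> \<Omega> \<and> (AE x in lebesgue. x \<in> \<Omega> - K \<longrightarrow> u x = 0)}"

text \<open>
  Weak solutions of \<open>- div(|x|\<^sup>\<mu> \<nabla>v) = |x|\<^sup>\<nu> |v|\<^sup>p\<^sup>-\<^sup>1 v\<close> in \<open>\<Omega>\<close>, and their stability. Membership in the
  Sobolev spaces guarantees that the weak gradients exist; as they are unique almost everywhere, the
  quantification over \<open>Dv\<close>, \<open>D\<phi>\<close>, \<open>D\<psi>\<close> just names \<open>\<nabla>v\<close>, \<open>\<nabla>\<phi>\<close>, \<open>\<nabla>\<psi>\<close>. Integrability of the integrands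
  is automatic if \<open>0 \<notin> \<Omega>\<close>; it is stated because the Lebesgue integral of a non-integrable
  function is 0 by convention.
\<close>

definition is_solution ::
    "real \<Rightarrow> real \<Rightarrow> real \<Rightarrow> 'a::euclidean_space set \<Rightarrow> ('a \<Rightarrow> real) \<Rightarrow> bool" where
  "is_solution \<mu> \<nu> p \<Omega> v \<longleftrightarrow> v \<in> H1_loc \<mu> \<Omega> \<inter> Linfty_loc \<Omega> \<and>
     (\<forall>\<phi>\<in>H1_c \<mu> \<Omega> \<inter> Linfty_loc \<Omega>. \<forall>Dv D\<phi>.
        weak_gradient \<Omega> v Dv \<longrightarrow> weak_gradient \<Omega> \<phi> D\<phi> \<longrightarrow>
        (\<lambda>x. norm x powr \<mu> * (Dv x \<bullet> D\<phi> x)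
             - norm x powr \<nu> * \<bar>v x\<bar> powr (p - 1) * v x * \<phi> x) absolutely_integrable_on \<Omega> \<and>
        (LINT x:\<Omega>|lebesgue. norm x powr \<mu> * (Dv x \<bullet> D\<phi> x)
             - norm x powr \<nu> * \<bar>v x\<bar> powr (p - 1) * v x * \<phi> x) = 0)"

definition is_stable ::
    "real \<Rightarrow> real \<Rightarrow> real \<Rightarrow> 'a::euclidean_space set \<Rightarrow> ('a \<Rightarrow> real) \<Rightarrow> bool" where
  "is_stable \<mu> \<nu> p \<Omega> v \<longleftrightarrow>
     (\<forall>\<psi>\<in>H1_c \<mu> \<Omega> \<inter> Linfty_loc \<Omega>. \<forall>D\<psi>. weak_gradient \<Omega> \<psi> D\<psi> \<longrightarrow>
        (\<lambda>x. norm x powr \<mu> * (norm (D\<psi> x))\<^sup>2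
             - p * norm x powr \<nu> * \<bar>v x\<bar> powr (p - 1) * (\<psi> x)\<^sup>2) absolutely_integrable_on \<Omega> \<and>
        (LINT x:\<Omega>|lebesgue. norm x powr \<mu> * (norm (D\<psi> x))\<^sup>2
             - p * norm x powr \<nu> * \<bar>v x\<bar> powr (p - 1) * (\<psi> x)\<^sup>2) \<ge> 0)"

end

theory Submission
  imports Defs
begin

text \<open>
  The inversion \<open>\<Phi>(x) = x / |x|\<^sup>2\<close> is a conformal involution of \<open>\<real>\<^sup>N - {0}\<close>: its derivative at \<open>x\<close> is
  \<open>|x|\<^sup>-\<^sup>2\<close> times a reflection and its Jacobian has modulus \<open>|x|\<^sup>-\<^sup>2\<^sup>N\<close>. Hence \<open>y = \<Phi>(x)\<close> turns
  \<open>|x|\<^sup>\<theta> \<nabla>v\<cdot>\<nabla>\<phi> dx\<close> and \<open>|x|\<^sup>l f dx\<close> into the same expressions with exponents \<open>4 - 2N - \<theta>\<close> and \<open>-2N - l\<close>.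
  As \<open>\<Phi>\<close> also maps the test spaces of the two problems onto each other, the weak equation and the
  stability inequality are both transported, in either direction. Weak gradients follow the chain
  rule because, for a test function \<open>\<phi>\<close> and a constant field \<open>b\<close>, the Piola identity makes
  \<open>|det D\<Phi>| (\<partial>\<^sub>b\<phi>) \<circ> \<Phi>\<close> the divergence of a compactly supported smooth field; no density argument is needed.
  Every pair of a function and a weak gradient is transported as such, so uniqueness of weak
  gradients is not needed either.
\<close>

section \<open>Permuting coordinates\<close>

text \<open>The two index types may differ, so for a bijection this is an isometry that carries
  statements on \<open>real ^ 'm\<close> over to \<open>real ^ 'n\<close>.\<close>

definition reindex :: "('m \<Rightarrow> 'n) \<Rightarrow> real ^ 'n \<Rightarrow> real ^ 'm" where
  "reindex \<pi> x = (\<chi> i. x $ \<pi> i)"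

lemma prod_Basis_vec:
  fixes v :: "real ^ 'n"
  shows "(\<Prod>b\<in>Basis. v \<bullet> b) = (\<Prod>i\<in>UNIV. v $ i)"
proof -
  have Basis_eq: "(Basis :: (real ^ 'n) set) = (\<lambda>i. axis i 1) ` UNIV"
    by (auto simp: Basis_vec_def)
  have "inj (\<lambda>i. axis i 1 :: real ^ 'n)"
    by (auto simp: inj_on_def axis_eq_axis)
  then show ?thesis
    unfolding Basis_eq by (subst prod.reindex) (auto simp: inner_axis)
qed

text \<open>Lebesgue measure is determined by its values on boxes, and the preimage of a box is a
  box with the same side lengths in another order.\<close>

lemma lborel_distr_reindex:
  fixes \<pi> :: "'m::finite \<Rightarrow> 'n::finite"
  assumes "bij \<pi>"
  shows "distr lborel borel (reindex \<pi>) = lborel"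
proof (rule lborel_eqI[symmetric])
  have meas: "reindex \<pi> \<in> borel \<rightarrow>\<^sub>M borel"
    unfolding reindex_def
    by (intro borel_measurable_continuous_onI continuous_intros)
  fix l u :: "real ^ 'm" assume le: "\<And>b. b \<in> Basis \<Longrightarrow> l \<bullet> b \<le> u \<bullet> b"
  then have le': "l $ i \<le> u $ i" for i
    by (metis axis_in_Basis_iff cart_eq_inner_axis Basis_real_def insertI1)
  define l' u' :: "real ^ 'n" where "l' = (\<chi> j. l $ inv \<pi> j)" and "u' = (\<chi> j. u $ inv \<pi> j)"
  have "reindex \<pi> -` box l u = box l' u'"
    unfolding l'_def u'_def using assms
    by (auto simp: mem_box_cart reindex_def)
      (metis bij_inv_eq_iff, metis bij_inv_eq_iff, metis bij_inv_eq_iff assms, metis bij_inv_eq_iff assms)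
  moreover have "(\<Prod>j\<in>UNIV. u' $ j - l' $ j) = (\<Prod>i\<in>UNIV. u $ i - l $ i)"
    unfolding l'_def u'_def using assms
    by (intro prod.reindex_bij_witness[of _ \<pi> "inv \<pi>"]) (auto simp: bij_is_inj bij_is_surj surj_f_inv_f)
  moreover have "\<And>b. b \<in> Basis \<Longrightarrow> l' \<bullet> b \<le> u' \<bullet> b"
    using le' by (auto simp: Basis_vec_def l'_def u'_def inner_axis)
  ultimately show "emeasure (distr lborel borel (reindex \<pi>)) (box l u) = (\<Prod>b\<in>Basis. (u - l) \<bullet> b)"
    using meas by (simp add: emeasure_distr prod_Basis_vec)
qed auto

text \<open>Passage from Borel sets to the completion. A measurable map into a completed measure
  space must pull null sets back to null sets, which follows from the invariance of
  \<open>lborel\<close>.\<close>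

lemma
  fixes \<pi> :: "'m::finite \<Rightarrow> 'n::finite"
  assumes "bij \<pi>"
  shows lebesgue_measurable_reindex: "reindex \<pi> \<in> lebesgue \<rightarrow>\<^sub>M lebesgue"
    and lebesgue_distr_reindex: "distr lebesgue lebesgue (reindex \<pi>) = lebesgue"
proof -
  have T_borel[measurable]: "reindex \<pi> \<in> borel \<rightarrow>\<^sub>M borel"
    unfolding reindex_def
    by (intro borel_measurable_continuous_onI continuous_intros)
  have T_lborel: "reindex \<pi> \<in> lborel \<rightarrow>\<^sub>M lborel" by simp
  have d: "distr lebesgue lborel (reindex \<pi>) = lborel"
    using distr_completion[OF T_lborel] lborel_distr_reindex[OF assms]
      distr_cong[of lborel lborel lborel borel "reindex \<pi>" "reindex \<pi>"] by simp
  then have eq: "null_sets lborel = null_sets (distr lebesgue lborel (reindex \<pi>))"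
    by simp
  show "reindex \<pi> \<in> lebesgue \<rightarrow>\<^sub>M lebesgue"
    by (simp add: completion.measurable_completion2 eq measurable_completion)
  have "completion (distr lebesgue lborel (reindex \<pi>)) = distr lebesgue lebesgue (reindex \<pi>)"
    by (rule completion.completion_distr_eq) (auto simp: d measurable_completion)
  then show "distr lebesgue lebesgue (reindex \<pi>) = lebesgue"
    by (simp add: d)
qed

lemma lebesgue_integrable_reindex:
  fixes \<pi> :: "'m::finite \<Rightarrow> 'n::finite" and f :: "real ^ 'm \<Rightarrow> real"
  assumes "bij \<pi>" "integrable lebesgue f"
  shows "integrable lebesgue (\<lambda>x. f (reindex \<pi> x))"
    "(\<integral>x. f (reindex \<pi> x) \<partial>lebesgue) = (\<integral>x. f x \<partial>lebesgue)"
proof -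
  note m = lebesgue_measurable_reindex[OF assms(1)]
  show "integrable lebesgue (\<lambda>x. f (reindex \<pi> x))"
    using integrable_distr[OF m, of f] assms by (simp add: lebesgue_distr_reindex)
  show "(\<integral>x. f (reindex \<pi> x) \<partial>lebesgue) = (\<integral>x. f x \<partial>lebesgue)"
    using integral_distr[OF m, of f] assms(2) 
    by (simp add: lebesgue_distr_reindex[OF assms(1)] borel_measurable_integrable)
qed

section \<open>A well-ordered copy of a finite index type\<close>

text \<open>
  The change of variables theorem of the library requires a well-ordered index type; every finite
  type is in bijection with one.
\<close>

typedef 'a wo = "UNIV :: 'a set" ..

instance wo :: (finite) finite
proof
  have "(UNIV :: 'a wo set) = range Abs_wo"
    by (metis Rep_wo_inverse surjI)
  then show "finite (UNIV :: 'a wo set)"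
    by (metis finite finite_imageI)
qed

text \<open>Any injection into the naturals serves; the order on \<open>'a wo\<close> is pulled back
  along it.\<close>

definition wo_index :: "'a::finite wo \<Rightarrow> nat" where
  "wo_index = (SOME f. inj f)"

lemma inj_wo_index: "inj (wo_index :: 'a::finite wo \<Rightarrow> nat)"
proof -
  have "\<exists>f :: 'a wo \<Rightarrow> nat. inj f"
    using finite_imp_inj_to_nat_seg[OF finite[of "UNIV :: 'a wo set"]] by auto
  then show ?thesis
    unfolding wo_index_def by (rule someI_ex)
qed

instantiation wo :: (finite) wellorder
begin

definition less_eq_wo :: "'a wo \<Rightarrow> 'a wo \<Rightarrow> bool" where
  "less_eq_wo x y \<longleftrightarrow> wo_index x \<le> wo_index y"

definition less_wo :: "'a wo \<Rightarrow> 'a wo \<Rightarrow> bool" where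
  "less_wo x y \<longleftrightarrow> wo_index x < wo_index y"

instance
proof
  fix P :: "'a wo \<Rightarrow> bool" and a :: "'a wo"
  assume step: "\<And>x. (\<And>y. y < x \<Longrightarrow> P y) \<Longrightarrow> P x"
  show "P a"
    by (induction a rule: measure_induct_rule[of wo_index]) (auto intro: step simp: less_wo_def)
qed (auto simp: less_eq_wo_def less_wo_def dest: injD[OF inj_wo_index])

end

lemma bij_Rep_wo: "bij Rep_wo"
  by (intro o_bij[of Abs_wo]) (auto simp: Rep_wo_inverse Abs_wo_inverse)

section \<open>The inversion\<close>

text \<open>The origin is fixed, so the map is an involution of the whole space and its algebraic
  identities hold without excluding 0.\<close>

definition inversion :: "'a::real_inner \<Rightarrow> 'a" where
  "inversion x = x /\<^sub>R (norm x)\<^sup>2"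

text \<open>Up to the factor \<open>|x|\<^sup>-\<^sup>2\<close>, the reflection in the hyperplane
  orthogonal to \<open>x\<close>.\<close>

definition inversion_deriv :: "'a::real_inner \<Rightarrow> 'a \<Rightarrow> 'a" where
  "inversion_deriv x h = (h - (2 * (x \<bullet> h) / (norm x)\<^sup>2) *\<^sub>R x) /\<^sub>R (norm x)\<^sup>2"

lemma inversion_0 [simp]: "inversion 0 = 0"
  by (simp add: inversion_def)

lemma norm_inversion [simp]: "norm (inversion x) = inverse (norm x)"
  by (cases "x = 0") (simp_all add: inversion_def power2_eq_square field_simps)

lemma inversion_inversion [simp]: "inversion (inversion x) = x"
  by (cases "x = 0") (simp_all add: inversion_def power2_eq_square field_simps)

lemma inversion_eq_0_iff [simp]: "inversion x = 0 \<longleftrightarrow> x = 0"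
  by (metis inversion_0 inversion_inversion)

lemma inj_inversion: "inj_on inversion S"
  by (metis inj_onI inversion_inversion)

lemma inversion_image_image [simp]: "inversion ` inversion ` S = S"
  by (simp add: image_image)

lemma inversion_mem_image_iff [simp]: "inversion x \<in> inversion ` S \<longleftrightarrow> x \<in> S"
  by (metis image_iff inversion_inversion)

lemma zero_mem_inversion_image_iff [simp]: "0 \<in> inversion ` S \<longleftrightarrow> 0 \<in> S"
  by (metis inversion_0 inversion_mem_image_iff)

lemma inversion_has_derivative:
  fixes x :: "'a::real_inner"
  assumes "x \<noteq> 0"
  shows "(inversion has_derivative inversion_deriv x) (at x within S)"
proof -
  have "((\<lambda>x. inverse (x \<bullet> x) *\<^sub>R x) has_derivative
      (\<lambda>h. inverse (x \<bullet> x) *\<^sub>R h + (- (inverse (x \<bullet> x) * (x \<bullet> h + h \<bullet> x) * inverse (x \<bullet> x))) *\<^sub>R x)) (at x within S)"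
    using assms by (auto intro!: derivative_eq_intros)
  moreover have "inversion = (\<lambda>x::'a. inverse (x \<bullet> x) *\<^sub>R x)"
    by (simp add: inversion_def fun_eq_iff power2_norm_eq_inner)
  moreover have "(\<lambda>h. inverse (x \<bullet> x) *\<^sub>R h + (- (inverse (x \<bullet> x) * (x \<bullet> h + h \<bullet> x) * inverse (x \<bullet> x))) *\<^sub>R x)
    = inversion_deriv x"
    by (simp add: inversion_deriv_def fun_eq_iff power2_norm_eq_inner inner_commute
       scaleR_diff_right field_simps)
  ultimately show ?thesis by simp
qed

text \<open>Conformality: a reflection preserves inner products and the scalar factor enters twice.
  At the origin both sides are 0, since division by 0 gives 0.\<close>

lemma inner_inversion_deriv:
  "inversion_deriv x a \<bullet> inversion_deriv x b = (a \<bullet> b) / norm x ^ 4"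
proof (cases "x = 0")
  case False
  have "x \<bullet> x \<noteq> 0" "norm x ^ 4 = (x \<bullet> x)^2" using False
    by (auto simp: power2_norm_eq_inner[symmetric])
  then show ?thesis
    by (simp add: inversion_deriv_def power2_norm_eq_inner inner_diff_left inner_diff_right inner_commute)
      (simp add: field_simps power2_eq_square)
qed (simp add: inversion_deriv_def)

lemma norm_inversion_deriv: "norm (inversion_deriv x a) = norm a / (norm x)\<^sup>2"
proof -
  have "norm x ^ 4 = ((norm x)\<^sup>2)\<^sup>2" by simp
  then have "(norm (inversion_deriv x a))\<^sup>2 = (norm a / (norm x)\<^sup>2)\<^sup>2"
    by (metis inner_inversion_deriv power2_norm_eq_inner power_divide)
  then show ?thesis
    by (simp add: power2_eq_iff_nonneg)
qed

text \<open>Reflections are symmetric. Hence the transpose in the chain rule for gradients is the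
  derivative itself.\<close>

lemma inversion_deriv_adjoint: "inversion_deriv x a \<bullet> b = a \<bullet> inversion_deriv x b"
  by (simp add: inversion_deriv_def inner_diff_left inner_diff_right inner_commute field_simps)

lemma linear_inversion_deriv: "linear (inversion_deriv x)"
  by (auto intro!: linearI simp: inversion_deriv_def inner_add_right algebra_simps add_divide_distrib)

text \<open>Scaling the derivative by \<open>x \<bullet> x\<close> gives an orthogonal map
  \<open>Q\<close>, whose determinant has modulus 1; the scalar contributes one factor per
  dimension.\<close>

lemma abs_det_inversion_deriv:
  fixes x :: "real ^ 'n::finite"
  assumes "x \<noteq> 0"
  shows "\<bar>det (matrix (inversion_deriv x))\<bar> = inverse (x \<bullet> x) ^ CARD('n)"
proof -
  define Q where "Q = (\<lambda>h. (x \<bullet> x) *\<^sub>R inversion_deriv x h)"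
  have Q: "orthogonal_transformation Q"
    unfolding Q_def orthogonal_transformation_def
    using assms linear_inversion_deriv[of x]
    by (auto intro!: linear_compose_scale_right simp: inner_inversion_deriv power2_norm_eq_inner[symmetric] power4_eq_xxxx field_simps power2_eq_square)
  have "inversion_deriv x = (*\<^sub>R) (inverse (x \<bullet> x)) \<circ> Q"
    using assms by (auto simp: Q_def)
  then have "matrix (inversion_deriv x) = matrix ((*\<^sub>R) (inverse (x \<bullet> x)) :: real^'n \<Rightarrow> real^'n) ** matrix Q"
    using Q by (simp add: matrix_compose orthogonal_transformation_linear linear_scale_self)
  moreover have "\<bar>det (matrix Q)\<bar> = 1"
    using Q det_orthogonal_matrix orthogonal_transformation_matrix by fastforce
  ultimately show ?thesis
    by (simp add: det_mul abs_mult power_abs)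
qed

section \<open>Calculus of \<open>C\<^sup>k\<close> functions\<close>

text \<open>On an open set the derivative at a point depends only on values nearby, so equality on
  \<open>S\<close> passes to all the iterated derivatives.\<close>

lemma Ck_on_cong:
  fixes S :: "'a::euclidean_space set"
  assumes "open S" "\<And>x. x \<in> S \<Longrightarrow> f x = g x"
  shows "Ck_on k S f \<longleftrightarrow> Ck_on k S g"
  using assms(2)
proof (induction k arbitrary: f g)
  case 0
  then show ?case by (simp cong: continuous_on_cong)
next
  case (Suc k)
  have "(f has_derivative D) (at x) \<longleftrightarrow> (g has_derivative D) (at x)" if "x \<in> S" for x D
    using has_derivative_transform_within_open[OF _ assms(1) that] Suc.prems by metis
  then have eq: "frechet_derivative f (at x) = frechet_derivative g (at x)" if "x \<in> S" for x
    using that by (simp add: frechet_derivative_def)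
  have "f differentiable_on S \<longleftrightarrow> g differentiable_on S"
    using Suc.prems unfolding differentiable_on_def differentiable_def
    by (metis has_derivative_transform)
  moreover have "Ck_on k S (\<lambda>x. frechet_derivative f (at x) b) \<longleftrightarrow> Ck_on k S (\<lambda>x. frechet_derivative g (at x) b)" for b
    by (rule Suc.IH) (simp add: eq)
  ultimately show ?case by simp
qed

lemma Ck_on_Suc_imp:
  assumes "Ck_on (Suc k) S f"
  shows "Ck_on k S f"
  using assms
proof (induction k arbitrary: f)
  case 0
  then show ?case by (auto intro: differentiable_imp_continuous_on)
next
  case (Suc k)
  then show ?case by (metis Ck_on.simps(2))
qed

text \<open>Allows the derivative to be given by an explicit formula on \<open>S\<close>; the
  closure properties below all use it in inductions over \<open>k\<close> with the function kept
  arbitrary.\<close>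

lemma Ck_on_SucI:
  fixes S :: "'a::euclidean_space set"
  assumes "open S" "\<And>x. x \<in> S \<Longrightarrow> (f has_derivative D x) (at x)"
    and "\<And>b. b \<in> Basis \<Longrightarrow> Ck_on k S (\<lambda>x. D x b)"
  shows "Ck_on (Suc k) S f"
proof -
  have "f differentiable_on S"
    using assms(2) by (meson differentiable_at_withinI differentiable_def differentiable_on_def)
  moreover have "frechet_derivative f (at x) = D x" if "x \<in> S" for x
    using assms(2)[OF that] by (metis frechet_derivative_at)
  ultimately show ?thesis
    using assms(1,3) by (simp cong: Ck_on_cong)
qed

lemma Ck_on_Suc_has_derivative:
  fixes S :: "'a::euclidean_space set"
  assumes "open S" "Ck_on (Suc k) S f" "x \<in> S"
  shows "(f has_derivative frechet_derivative f (at x)) (at x)"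
  using assms by (metis Ck_on.simps(2) at_within_open differentiable_on_def frechet_derivative_works)

section \<open>Closure properties of \<open>C\<^sup>k\<close> functions\<close>

lemma Ck_on_const: "open S \<Longrightarrow> Ck_on k S (\<lambda>x::'a::euclidean_space. c)"
proof (induction k arbitrary: c)
  case (Suc k)
  show ?case
    by (rule Ck_on_SucI[OF \<open>open S\<close>, where D = "\<lambda>_ _. 0"]) (auto intro: Suc)
qed simp

lemma Ck_on_add:
  fixes S :: "'a::euclidean_space set"
  assumes "open S" "Ck_on k S f" "Ck_on k S g"
  shows "Ck_on k S (\<lambda>x. f x + g x)"
  using assms(2,3)
proof (induction k arbitrary: f g)
  case (Suc k)
  show ?case
  proof (rule Ck_on_SucI[OF \<open>open S\<close>])
    show "((\<lambda>x. f x + g x) has_derivative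
        (\<lambda>h. frechet_derivative f (at x) h + frechet_derivative g (at x) h)) (at x)" if "x \<in> S" for x
      using Suc.prems that Ck_on_Suc_has_derivative[OF \<open>open S\<close>] by (intro has_derivative_add)
  qed (use Suc in auto)
qed (auto intro: continuous_intros)

lemma Ck_on_mult:
  fixes S :: "'a::euclidean_space set"
  assumes "open S" "Ck_on k S f" "Ck_on k S g"
  shows "Ck_on k S (\<lambda>x. f x * g x)"
  using assms(2,3)
proof (induction k arbitrary: f g)
  case (Suc k)
  show ?case
  proof (rule Ck_on_SucI[OF \<open>open S\<close>])
    show "((\<lambda>x. f x * g x) has_derivative
        (\<lambda>h. f x * frechet_derivative g (at x) h + frechet_derivative f (at x) h * g x)) (at x)" if "x \<in> S" for x
      using Suc.prems that Ck_on_Suc_has_derivative[OF \<open>open S\<close>] by (intro has_derivative_mult)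
  qed (use Suc Ck_on_Suc_imp[OF Suc.prems(1)] Ck_on_Suc_imp[OF Suc.prems(2)] in
      \<open>auto intro!: Ck_on_add \<open>open S\<close>\<close>)
qed (auto intro: continuous_intros)

lemma Ck_on_sum:
  fixes S :: "'a::euclidean_space set"
  assumes "open S" "\<And>i. i \<in> I \<Longrightarrow> Ck_on k S (f i)"
  shows "Ck_on k S (\<lambda>x. \<Sum>i\<in>I. f i x)"
  using assms(2)
  by (induction I rule: infinite_finite_induct) (auto intro: Ck_on_const Ck_on_add assms(1))

lemma Ck_on_power:
  fixes S :: "'a::euclidean_space set"
  assumes "open S" "Ck_on k S f"
  shows "Ck_on k S (\<lambda>x. f x ^ n)"
  using assms by (induction n) (auto intro: Ck_on_const Ck_on_mult)

lemma Ck_on_inner_const: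
  fixes S :: "'a::euclidean_space set"
  assumes "open S"
  shows "Ck_on k S (\<lambda>x. x \<bullet> c)"
proof (cases k)
  case (Suc k)
  show ?thesis
    unfolding Suc
    by (rule Ck_on_SucI[OF \<open>open S\<close>, where D = "\<lambda>_ h. h \<bullet> c"])
      (auto intro: Ck_on_const assms derivative_eq_intros)
qed (simp add: continuous_on_inner)

lemma Ck_on_inner_self:
  fixes S :: "'a::euclidean_space set"
  assumes "open S"
  shows "Ck_on k S (\<lambda>x. x \<bullet> x)"
proof -
  have "Ck_on k S (\<lambda>x. \<Sum>b\<in>Basis. (x \<bullet> b) * (x \<bullet> b))"
    by (intro Ck_on_sum Ck_on_mult Ck_on_inner_const assms)
  then show ?thesis by (simp flip: euclidean_inner)
qed

text \<open>The derivative of \<open>inverse (f x)\<close> is again a product of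
  \<open>inverse (f x)\<close> and derivatives of \<open>f\<close>, so the induction hypothesis and
  the product rule close the step.\<close>

lemma Ck_on_inverse:
  fixes S :: "'a::euclidean_space set"
  assumes "open S" "Ck_on k S f" "\<And>x. x \<in> S \<Longrightarrow> f x \<noteq> 0"
  shows "Ck_on k S (\<lambda>x. inverse (f x))"
  using assms(2,3)
proof (induction k arbitrary: f)
  case 0
  then have "continuous_on S f" "\<forall>x\<in>S. f x \<noteq> 0" by auto
  from continuous_on_inverse[OF this] show ?case by simp
next
  case (Suc k)
  show ?case
  proof (rule Ck_on_SucI[OF \<open>open S\<close>])
    show "((\<lambda>x. inverse (f x)) has_derivative
        (\<lambda>h. (- 1) * (inverse (f x) * (frechet_derivative f (at x) h * inverse (f x))))) (at x)" if "x \<in> S" for x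
      using Suc.prems that Ck_on_Suc_has_derivative[OF \<open>open S\<close>]
      by (auto intro!: derivative_eq_intros)
  next
    fix b :: 'a assume "b \<in> Basis"
    then show "Ck_on k S (\<lambda>x. (- 1) * (inverse (f x) * (frechet_derivative f (at x) b * inverse (f x))))"
      using Suc Ck_on_Suc_imp[OF Suc.prems(1)] by (intro Ck_on_mult Ck_on_const \<open>open S\<close>) auto
  qed
qed

text \<open>By the chain rule a partial derivative of the composite is a sum of products, with
  factors covered by the induction hypothesis. The inner map is smooth of every order, so its
  assumption is the same at each step.\<close>

lemma Ck_on_compose:
  fixes S :: "'a::euclidean_space set" and T :: "'b::euclidean_space set" and \<Phi> :: "'a \<Rightarrow> 'b"
  assumes "open S" "open T" "\<And>x. x \<in> S \<Longrightarrow> \<Phi> x \<in> T"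
    and \<Phi>: "\<And>k b. b \<in> Basis \<Longrightarrow> Ck_on k S (\<lambda>x. \<Phi> x \<bullet> b)"
    and "Ck_on k T f"
  shows "Ck_on k S (\<lambda>x. f (\<Phi> x))"
  using assms(5)
proof (induction k arbitrary: f)
  case 0
  have "continuous_on S \<Phi>"
    using \<Phi>[of _ 0] by (subst continuous_on_componentwise) simp
  then show ?case
    using 0 assms(3) continuous_on_compose2[of T f S \<Phi>] by auto
next
  case (Suc k)
  \<comment> \<open>The derivative of the vector-valued map, assembled from those of its components,
    since \<open>Ck_on\<close> speaks of real-valued functions only.\<close>
  define D\<Phi> where "D\<Phi> x h = (\<Sum>b\<in>Basis. frechet_derivative (\<lambda>x. \<Phi> x \<bullet> b) (at x) h *\<^sub>R b)" for x h
  have D\<Phi>: "(\<Phi> has_derivative D\<Phi> x) (at x)" if "x \<in> S" for x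
    unfolding D\<Phi>_def
    using Ck_on_Suc_has_derivative[OF \<open>open S\<close> \<Phi>[of _ "Suc 0"] that]
    by (subst has_derivative_componentwise_within) (simp add: inner_sum_left inner_Basis if_distrib cong: if_cong)
  show ?case
  proof (rule Ck_on_SucI[OF \<open>open S\<close>])
    fix x assume x: "x \<in> S"
    have f: "(f has_derivative frechet_derivative f (at (\<Phi> x))) (at (\<Phi> x))"
      using Ck_on_Suc_has_derivative[OF \<open>open T\<close> Suc.prems] x assms(3) by blast
    then have lin: "linear (frechet_derivative f (at (\<Phi> x)))"
      by (rule has_derivative_linear)
    have "((\<lambda>x. f (\<Phi> x)) has_derivative (\<lambda>h. frechet_derivative f (at (\<Phi> x)) (D\<Phi> x h))) (at x)"
      using has_derivative_compose[OF D\<Phi>[OF x] f] .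
    then show "((\<lambda>x. f (\<Phi> x)) has_derivative (\<lambda>h. \<Sum>b\<in>Basis.
        frechet_derivative (\<lambda>x. \<Phi> x \<bullet> b) (at x) h * frechet_derivative f (at (\<Phi> x)) b)) (at x)"
      unfolding D\<Phi>_def by (simp add: linear_sum[OF lin] linear_cmul[OF lin])
  next
    fix i :: 'a assume i: "i \<in> Basis"
    have "Ck_on k S (\<lambda>x. frechet_derivative (\<lambda>x. \<Phi> x \<bullet> b) (at x) i)" if "b \<in> Basis" for b
      using \<Phi>[OF that, of "Suc k"] i by simp
    moreover have "Ck_on k S (\<lambda>x. frechet_derivative f (at (\<Phi> x)) b)" if "b \<in> Basis" for b
      using Suc.IH[of "\<lambda>y. frechet_derivative f (at y) b"] Suc.prems that by simp
    ultimately show "Ck_on k S (\<lambda>x. \<Sum>b\<in>Basis.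
        frechet_derivative (\<lambda>x. \<Phi> x \<bullet> b) (at x) i * frechet_derivative f (at (\<Phi> x)) b)"
      by (intro Ck_on_sum Ck_on_mult \<open>open S\<close>)
  qed
qed

section \<open>Change of variables and measurability\<close>

lemma reindex_inv:
  assumes "bij \<pi>"
  shows "reindex \<pi> (reindex (inv \<pi>) x) = x" "reindex (inv \<pi>) (reindex \<pi> y) = y"
  using assms by (simp_all add: reindex_def bij_is_inj bij_is_surj surj_f_inv_f)

text \<open>The inverse permutation gives the converse for integrability. Non-integrable functions
  have integral 0 on both sides, so the equality of integrals is unconditional.\<close>

lemma lebesgue_integral_reindex:
  fixes \<pi> :: "'m::finite \<Rightarrow> 'n::finite" and f :: "real ^ 'm \<Rightarrow> real"
  assumes "bij \<pi>"
  shows "integrable lebesgue (\<lambda>x. f (reindex \<pi> x)) \<longleftrightarrow> integrable lebesgue f"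
    "(\<integral>x. f (reindex \<pi> x) \<partial>lebesgue) = (\<integral>x. f x \<partial>lebesgue)"
proof -
  show *: "integrable lebesgue (\<lambda>x. f (reindex \<pi> x)) \<longleftrightarrow> integrable lebesgue f"
    using lebesgue_integrable_reindex(1)[OF assms, of f]
      lebesgue_integrable_reindex(1)[OF bij_imp_bij_inv[OF assms], of "\<lambda>x. f (reindex \<pi> x)"]
    by (auto simp: reindex_inv[OF assms])
  then show "(\<integral>x. f (reindex \<pi> x) \<partial>lebesgue) = (\<integral>x. f x \<partial>lebesgue)"
    using lebesgue_integrable_reindex(2)[OF assms] by (metis not_integrable_integral_eq)
qed

lemma set_lebesgue_integral_reindex:
  fixes \<pi> :: "'m::finite \<Rightarrow> 'n::finite" and f :: "real ^ 'm \<Rightarrow> real"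
  assumes "bij \<pi>"
  shows "(\<lambda>x. f (reindex \<pi> x)) absolutely_integrable_on (reindex \<pi> -` S) \<longleftrightarrow> f absolutely_integrable_on S"
    "(LINT x:(reindex \<pi> -` S)|lebesgue. f (reindex \<pi> x)) = (LINT x:S|lebesgue. f x)"
  using lebesgue_integral_reindex[OF assms, of "\<lambda>x. indicator S x *\<^sub>R f x"]
  by (simp_all add: set_integrable_def set_lebesgue_integral_def indicator_vimage)

lemma inner_reindex:
  fixes \<pi> :: "'m::finite \<Rightarrow> 'n::finite"
  assumes "bij \<pi>"
  shows "reindex \<pi> x \<bullet> reindex \<pi> y = x \<bullet> y"
  unfolding inner_vec_def reindex_def
  using assms by (simp add: sum.reindex_bij_betw[of \<pi> UNIV UNIV "\<lambda>i. x $ i * y $ i"])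

lemma inversion_reindex:
  fixes \<pi> :: "'m::finite \<Rightarrow> 'n::finite"
  assumes "bij \<pi>"
  shows "inversion (reindex \<pi> x) = reindex \<pi> (inversion x)"
proof -
  have "reindex \<pi> (c *\<^sub>R x) = c *\<^sub>R reindex \<pi> x" for c
    by (simp add: reindex_def vec_eq_iff)
  then show ?thesis
    by (simp add: inversion_def power2_norm_eq_inner inner_reindex[OF assms])
qed

text \<open>The modulus \<open>|x|\<^sup>-\<^sup>2\<^sup>N\<close> of the Jacobian, as a natural
  power of \<open>inverse (x \<bullet> x)\<close> so that the rules for \<open>Ck_on\<close>
  apply.\<close>

definition inversion_jac :: "real ^ 'n \<Rightarrow> real" where
  "inversion_jac x = inverse (x \<bullet> x) ^ CARD('n)"

text \<open>This is what differentiating \<open>inversion (inversion x) = x\<close> predicts; here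
  it is checked by computation.\<close>

lemma inversion_deriv_inverse:
  assumes "x \<noteq> 0"
  shows "inversion_deriv (inversion x) (inversion_deriv x h) = h"
proof -
  have "x \<bullet> x \<noteq> 0" using assms by simp
  then show ?thesis
    unfolding inversion_deriv_def inversion_def
    by (simp add: power2_norm_eq_inner inner_diff_right algebra_simps scaleR_diff_right)
       (simp add: field_simps power2_eq_square power4_eq_xxxx flip: scaleR_add_left)
qed

text \<open>The inversion is its own differentiable inverse away from 0, so the theorem for
  invertible maps applies to any set avoiding the origin, measurable or not.\<close>

lemma inversion_change_of_variables_wo:
  fixes f :: "real ^ 'n::{finite,wellorder} \<Rightarrow> real"
  assumes "0 \<notin> S"
  shows "(\<lambda>x. inversion_jac x * f (inversion x)) absolutely_integrable_on S
      \<longleftrightarrow> f absolutely_integrable_on inversion ` S" (is "?A \<longleftrightarrow> ?B")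
    and "(LINT x:S|lebesgue. inversion_jac x * f (inversion x))
      = (LINT x:inversion ` S|lebesgue. f x)" (is "?C = ?D")
proof -
  have S: "x \<noteq> 0" if "x \<in> S" for x using assms that by auto
  let ?d = "\<lambda>x. \<bar>det (matrix (inversion_deriv x))\<bar> * f (inversion x)"
  have "?d absolutely_integrable_on S \<and> integral S ?d = b \<longleftrightarrow>
      f absolutely_integrable_on inversion ` S \<and> integral (inversion ` S) f = b" for b
  proof (rule cov_invertible_real[where h = inversion and h' = inversion_deriv])
    fix y assume "y \<in> inversion ` S"
    then have "inversion y \<noteq> 0" using S by auto
    from inversion_deriv_inverse[OF this]
    show "inversion_deriv y \<circ> inversion_deriv (inversion y) = id" by auto
  qed (use S in \<open>auto intro!: inversion_has_derivative\<close>)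
  moreover have "?d absolutely_integrable_on S \<longleftrightarrow> ?A"
    by (intro set_integrable_cong) (auto simp: S abs_det_inversion_deriv inversion_jac_def)
  moreover have "integral S ?d = integral S (\<lambda>x. inversion_jac x * f (inversion x))"
    by (intro integral_cong) (auto simp: S abs_det_inversion_deriv inversion_jac_def)
  ultimately have *: "?A \<and> integral S (\<lambda>x. inversion_jac x * f (inversion x)) = b \<longleftrightarrow>
      ?B \<and> integral (inversion ` S) f = b" for b
    by simp
  then show AB: "?A \<longleftrightarrow> ?B" by blast
  show "?C = ?D"
  \<comment> \<open>The formula obtained so far is about gauge integrals. These agree with the
    Lebesgue integrals for absolutely integrable functions; otherwise both Lebesgue integrals are
    0.\<close>
  proof (cases ?B)
    case True
    then show ?thesis
      using * AB set_lebesgue_integral_eq_integral(2) by metis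
  next
    case False
    then show ?thesis
      using AB by (simp add: set_lebesgue_integral_def set_integrable_def not_integrable_integral_eq)
  qed
qed

lemma CARD_wo: "CARD('a wo) = CARD('a::finite)"
  by (rule bij_betw_same_card[OF bij_Rep_wo])

lemma inversion_image_eq: "inversion ` S = inversion -` S"
  by (auto intro: rev_image_eqI)

text \<open>The restriction on the index type is removed by conjugation: reindexing commutes with
  the inversion and preserves integrals, inner products and the dimension, hence also the
  Jacobian.\<close>

lemma
  fixes f :: "real ^ 'n::finite \<Rightarrow> real"
  assumes "0 \<notin> S"
  shows absolutely_integrable_on_inversion_image:
      "f absolutely_integrable_on inversion ` S
        \<longleftrightarrow> (\<lambda>x. inversion_jac x * f (inversion x)) absolutely_integrable_on S"
    and LINT_inversion_image:
      "(LINT x:inversion ` S|lebesgue. f x)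
        = (LINT x:S|lebesgue. inversion_jac x * f (inversion x))"
proof -
  let ?r = "reindex (inv Rep_wo) :: real ^ 'n wo \<Rightarrow> real ^ 'n"
  have bij: "bij (inv Rep_wo :: 'n \<Rightarrow> 'n wo)"
    by (simp add: bij_Rep_wo bij_imp_bij_inv)
  note r = set_lebesgue_integral_reindex[OF bij]
  have r0: "?r x = 0 \<longleftrightarrow> x = 0" for x
    by (metis inner_eq_zero_iff inner_reindex[OF bij])
  have *: "?r -` (inversion ` S) = inversion ` (?r -` S)"
    by (auto simp: inversion_image_eq inversion_reindex[OF bij])
  have 0: "0 \<notin> ?r -` S" using assms r0 by (metis vimageD)
  have jac: "inversion_jac (?r x) = inversion_jac x" for x
    by (simp add: inversion_jac_def inner_reindex[OF bij] CARD_wo)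
  show "f absolutely_integrable_on inversion ` S
      \<longleftrightarrow> (\<lambda>x. inversion_jac x * f (inversion x)) absolutely_integrable_on S"
    using r(1)[where f = f and S = "inversion ` S"]
      r(1)[where f = "\<lambda>x. inversion_jac x * f (inversion x)" and S = S]
      inversion_change_of_variables_wo(1)[OF 0, where f = "\<lambda>x. f (?r x)"]
    by (simp add: * jac inversion_reindex[OF bij])
  show "(LINT x:inversion ` S|lebesgue. f x)
      = (LINT x:S|lebesgue. inversion_jac x * f (inversion x))"
    using r(2)[where f = f and S = "inversion ` S"]
      r(2)[where f = "\<lambda>x. inversion_jac x * f (inversion x)" and S = S]
      inversion_change_of_variables_wo(2)[OF 0, where f = "\<lambda>x. f (?r x)"]
    by (simp add: * jac inversion_reindex[OF bij])
qed

section \<open>Open, compact, measurable and null sets under the inversion\<close>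

lemma continuous_on_inversion: "0 \<notin> S \<Longrightarrow> continuous_on S inversion"
  unfolding inversion_def by (auto intro!: continuous_intros)

lemma open_inversion_image:
  fixes S :: "'a::real_inner set"
  assumes "open S" "0 \<notin> S"
  shows "open (inversion ` S)"
proof -
  have "open (inversion -` S \<inter> - {0::'a})"
    using assms by (intro continuous_open_preimage[OF continuous_on_inversion, of "- {0}" S, unfolded Int_commute[of "- {0}"]]) auto
  moreover have "inversion -` S \<inter> - {0} = inversion ` S"
    using assms(2) by (auto simp: inversion_image_eq)
  ultimately show ?thesis by simp
qed

lemma compact_inversion_image: "compact K \<Longrightarrow> 0 \<notin> K \<Longrightarrow> compact (inversion ` K)"
  by (simp add: compact_continuous_image continuous_on_inversion)

lemma differentiable_on_inversion: "0 \<notin> S \<Longrightarrow> inversion differentiable_on S"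
  unfolding differentiable_on_def differentiable_def using inversion_has_derivative by metis

lemma lebesgue_inversion_image:
  fixes S :: "'a::euclidean_space set"
  shows "S \<in> sets lebesgue \<Longrightarrow> 0 \<notin> S \<Longrightarrow> inversion ` S \<in> sets lebesgue"
  by (simp add: differentiable_image_in_sets_lebesgue differentiable_on_inversion)

text \<open>Preimages under the composite are images under the inversion, and differentiable maps
  send Lebesgue measurable sets to Lebesgue measurable sets.\<close>

lemma measurable_inversion:
  fixes S :: "'a::euclidean_space set"
  assumes "f \<in> measurable (lebesgue_on S) M" "S \<in> sets lebesgue" "0 \<notin> S"
  shows "(\<lambda>y. f (inversion y)) \<in> measurable (lebesgue_on (inversion ` S)) M"
proof (rule measurableI)
  fix A assume "A \<in> sets M"
  then have "f -` A \<inter> S \<in> sets lebesgue"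
    using measurable_sets[OF assms(1)] assms(2) by (simp add: sets_restrict_space_iff)
  then have "inversion ` (f -` A \<inter> S) \<in> sets lebesgue"
    using assms(3) by (intro lebesgue_inversion_image) auto
  moreover have "inversion ` (f -` A \<inter> S) = (\<lambda>y. f (inversion y)) -` A \<inter> inversion ` S"
    by (auto simp: inversion_image_eq)
  ultimately show "(\<lambda>y. f (inversion y)) -` A \<inter> space (lebesgue_on (inversion ` S)) \<in> sets (lebesgue_on (inversion ` S))"
    using lebesgue_inversion_image[OF assms(2,3)] by (simp add: sets_restrict_space_iff)
qed (use assms measurable_space[OF assms(1)] in auto)

lemma AE_lebesgue_iff_negligible: "(AE x in lebesgue. P x) \<longleftrightarrow> negligible {x. \<not> P x}"
  by (auto simp: AE_iff_null_sets negligible_iff_null_sets eventually_ae_filter intro: completion.complete2)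

text \<open>The exceptional set is the image of a null set under a differentiable map, hence
  null.\<close>

lemma AE_inversion:
  fixes S :: "'a::euclidean_space set"
  assumes "AE x in lebesgue. x \<in> S \<longrightarrow> P x" "0 \<notin> S"
  shows "AE y in lebesgue. y \<in> inversion ` S \<longrightarrow> P (inversion y)"
proof -
  have "negligible {x \<in> S. \<not> P x}"
    using assms(1) by (simp add: AE_lebesgue_iff_negligible)
  then have "negligible (inversion ` {x \<in> S. \<not> P x})"
    using assms(2) by (intro negligible_differentiable_image_negligible differentiable_on_inversion) auto
  moreover have "inversion ` {x \<in> S. \<not> P x} = {y. \<not> (y \<in> inversion ` S \<longrightarrow> P (inversion y))}"
    by (auto simp: inversion_image_eq)
  ultimately show ?thesis
    by (simp add: AE_lebesgue_iff_negligible)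
qed

section \<open>Weak gradients under the inversion\<close>

lemma L1_loc_mult_continuous:
  fixes f w :: "'a::euclidean_space \<Rightarrow> real"
  assumes "f \<in> L1_loc \<Omega>" "continuous_on \<Omega> w"
  shows "(\<lambda>x. w x * f x) \<in> L1_loc \<Omega>"
  unfolding L1_loc_def
proof (intro CollectI allI impI)
  fix K assume K: "compact K \<and> K \<subseteq> \<Omega>"
  then have w: "continuous_on K w" using assms(2) continuous_on_subset by blast
  show "(\<lambda>x. w x * f x) absolutely_integrable_on K"
  proof (rule absolutely_integrable_bounded_measurable_product[OF bilinear_times])
    show "w \<in> borel_measurable (lebesgue_on K)"
      using K w by (simp add: continuous_imp_measurable_on_sets_lebesgue lmeasurable_compact fmeasurableD)
    show "bounded (w ` K)"
      using K w by (simp add: compact_continuous_image compact_imp_bounded)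
  qed (use K assms in \<open>auto simp: L1_loc_def lmeasurable_compact fmeasurableD\<close>)
qed

lemma L1_loc_componentwise:
  "f \<in> L1_loc \<Omega> \<longleftrightarrow> (\<forall>b\<in>Basis. (\<lambda>x. f x \<bullet> b) \<in> L1_loc \<Omega>)"
  unfolding L1_loc_def by (auto intro: absolutely_integrable_component absolutely_integrable_componentwise)

lemma L1_loc_sum:
  assumes "\<And>i. i \<in> I \<Longrightarrow> f i \<in> L1_loc \<Omega>" "finite I"
  shows "(\<lambda>x. \<Sum>i\<in>I. f i x) \<in> L1_loc \<Omega>"
  using assms unfolding L1_loc_def by (auto intro: absolutely_integrable_sum)

lemma L1_loc_cong:
  assumes "\<And>x. x \<in> \<Omega> \<Longrightarrow> f x = g x" "f \<in> L1_loc \<Omega>"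
  shows "g \<in> L1_loc \<Omega>"
  unfolding L1_loc_def
proof (intro CollectI allI impI)
  fix K assume "compact K \<and> K \<subseteq> \<Omega>"
  then show "g absolutely_integrable_on K"
    using assms by (subst set_integrable_cong[OF refl, where f' = f]) (auto simp: L1_loc_def)
qed

text \<open>The product vanishes off \<open>K\<close>, so integrability over \<open>K\<close>, where
  the continuous weight is bounded, is integrability over \<open>\<Omega>\<close>.\<close>

lemma absolutely_integrable_L1_loc_compact_support:
  fixes f w :: "'a::euclidean_space \<Rightarrow> real"
  assumes "f \<in> L1_loc \<Omega>" "continuous_on \<Omega> w" "compact K" "K \<subseteq> \<Omega>" "\<And>x. x \<notin> K \<Longrightarrow> w x = 0"
  shows "(\<lambda>x. f x * w x) absolutely_integrable_on \<Omega>"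
proof -
  have "(\<lambda>x. w x * f x) absolutely_integrable_on K"
    using L1_loc_mult_continuous[OF assms(1,2)] assms(3,4) by (auto simp: L1_loc_def)
  moreover have "(\<lambda>x. indicator K x *\<^sub>R (w x * f x)) = (\<lambda>x. indicator \<Omega> x *\<^sub>R (f x * w x))"
    using assms(4,5) by (auto simp: indicator_def fun_eq_iff)
  ultimately show ?thesis by (simp only: set_integrable_def)
qed

lemma frechet_derivative_eq_0_outside_support:
  assumes "x \<notin> closure {x. \<phi> x \<noteq> 0}"
  shows "frechet_derivative \<phi> (at x) = (\<lambda>_. 0)"
proof -
  have "((\<lambda>_. 0) has_derivative (\<lambda>_. 0)) (at x)" by simp
  then have "(\<phi> has_derivative (\<lambda>_. 0)) (at x)"
    by (rule has_derivative_transform_within_open[OF _ open_Compl[OF closed_closure[of "{x. \<phi> x \<noteq> 0}"]]])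
      (use assms closure_subset[of "{x. \<phi> x \<noteq> 0}"] in auto)
  then show ?thesis by (metis frechet_derivative_at)
qed

text \<open>Both integrals in the definition of a weak gradient thus converge, which later justifies
  exchanging them with finite sums.\<close>

lemma
  assumes "f \<in> L1_loc \<Omega>" "\<phi> \<in> test_functions \<Omega>"
  shows absolutely_integrable_L1_loc_test: "(\<lambda>x. f x * \<phi> x) absolutely_integrable_on \<Omega>"
    and absolutely_integrable_L1_loc_deriv_test:
      "b \<in> Basis \<Longrightarrow> (\<lambda>x. f x * frechet_derivative \<phi> (at x) b) absolutely_integrable_on \<Omega>"
proof -
  have C: "Ck_on k \<Omega> \<phi>" for k using assms(2) by (simp add: test_functions_def)
  have K: "compact (closure {x. \<phi> x \<noteq> 0})" "closure {x. \<phi> x \<noteq> 0} \<subseteq> \<Omega>"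
    using assms(2) by (simp_all add: test_functions_def)
  have 0: "\<phi> x = 0" if "x \<notin> closure {x. \<phi> x \<noteq> 0}" for x
    using that closure_subset[of "{x. \<phi> x \<noteq> 0}"] by auto
  show "(\<lambda>x. f x * \<phi> x) absolutely_integrable_on \<Omega>"
    using C[of 0] by (intro absolutely_integrable_L1_loc_compact_support[OF assms(1) _ K 0]) auto
  show "(\<lambda>x. f x * frechet_derivative \<phi> (at x) b) absolutely_integrable_on \<Omega>" if "b \<in> Basis"
    using C[of "Suc 0"] that
    by (intro absolutely_integrable_L1_loc_compact_support[OF assms(1) _ K])
      (auto simp: frechet_derivative_eq_0_outside_support)
qed

section \<open>Pulling back test functions\<close>

lemma Ck_on_inversion:
  fixes S :: "'a::euclidean_space set"
  assumes "open S" "0 \<notin> S"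
  shows "Ck_on k S (\<lambda>x. inversion x \<bullet> b)"
proof -
  have "Ck_on k S (\<lambda>x. inverse (x \<bullet> x) * (x \<bullet> b))"
    using assms by (intro Ck_on_mult Ck_on_inverse Ck_on_inner_self Ck_on_inner_const) auto
  then show ?thesis
    by (simp add: inversion_def power2_norm_eq_inner)
qed

text \<open>The support of the pullback lies in the image of the original support, which is compact
  because that support avoids 0. The smooth weight \<open>w\<close> makes room for the components of
  the Piola field.\<close>

lemma test_functions_inversion:
  fixes \<Omega> :: "'a::euclidean_space set"
  assumes "open \<Omega>" "0 \<notin> \<Omega>" "\<And>k. Ck_on k \<Omega> w" "\<phi> \<in> test_functions (inversion ` \<Omega>)"
  shows "(\<lambda>x. w x * \<phi> (inversion x)) \<in> test_functions \<Omega>"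
proof -
  let ?K = "closure {x. \<phi> x \<noteq> 0}" and ?K' = "closure {x. w x * \<phi> (inversion x) \<noteq> 0}"
  have K: "compact ?K" "?K \<subseteq> inversion ` \<Omega>"
    using assms(4) by (simp_all add: test_functions_def)
  then have 0: "0 \<notin> ?K" using assms(2) by auto
  then have c: "compact (inversion ` ?K)" using K by (simp add: compact_inversion_image)
  have "{x. w x * \<phi> (inversion x) \<noteq> 0} \<subseteq> inversion ` ?K"
    using closure_subset[of "{x. \<phi> x \<noteq> 0}"] by (auto simp: inversion_image_eq)
  then have sub: "?K' \<subseteq> inversion ` ?K"
    by (rule closure_minimal[OF _ compact_imp_closed[OF c]])
  moreover have "inversion ` ?K \<subseteq> \<Omega>"
    using K(2) image_mono[OF K(2), of inversion] by simp
  moreover have "compact ?K'"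
  proof -
    have "compact (inversion ` ?K \<inter> ?K')"
      by (rule compact_Int_closed[OF c closed_closure])
    then show ?thesis by (simp only: Int_absorb1[OF sub])
  qed
  moreover have "Ck_on k \<Omega> (\<lambda>x. w x * \<phi> (inversion x))" for k
  proof -
    have "Ck_on k \<Omega> (\<lambda>x. \<phi> (inversion x))"
      by (rule Ck_on_compose[OF assms(1) open_inversion_image[OF assms(1,2)] _ Ck_on_inversion[OF assms(1,2)]])
        (use assms(4) in \<open>auto simp: test_functions_def\<close>)
    then show ?thesis by (rule Ck_on_mult[OF assms(1,3)])
  qed
  ultimately show ?thesis by (auto simp: test_functions_def)
qed

section \<open>The Piola identity for the inversion\<close>

text \<open>
  The Piola transform of the constant field \<open>b\<close>, that is \<open>|det D\<Phi>(x)| (D\<Phi>(x))\<^sup>-\<^sup>1 b\<close>; it is divergence free.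
\<close>

definition inversion_piola :: "real ^ 'n \<Rightarrow> real ^ 'n \<Rightarrow> real ^ 'n" where
  "inversion_piola b x = inversion_jac x *\<^sub>R ((x \<bullet> x) *\<^sub>R b - (2 * (x \<bullet> b)) *\<^sub>R x)"

text \<open>By \<open>inversion_deriv_inverse\<close> the left side is the inverse derivative
  applied to \<open>b\<close>; this recognises the vector in \<open>inversion_piola\<close>.\<close>

lemma inversion_deriv_at_inversion:
  "x \<noteq> 0 \<Longrightarrow> inversion_deriv (inversion x) b = (x \<bullet> x) *\<^sub>R b - (2 * (x \<bullet> b)) *\<^sub>R x"
  unfolding inversion_deriv_def norm_inversion power_inverse
  by (simp add: inversion_def power2_norm_eq_inner scaleR_diff_right)

lemma Ck_on_inversion_piola:
  fixes S :: "(real ^ 'n) set"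
  assumes "open S" "0 \<notin> S"
  shows "Ck_on k S (\<lambda>x. inversion_piola b x \<bullet> i)"
proof -
  have "Ck_on k S (\<lambda>x. inverse (x \<bullet> x) ^ CARD('n) *
      ((x \<bullet> x) * (b \<bullet> i) + (- 2) * ((x \<bullet> b) * (x \<bullet> i))))"
    using assms
    by (intro Ck_on_mult Ck_on_power Ck_on_inverse Ck_on_add Ck_on_const Ck_on_inner_self Ck_on_inner_const) auto
  then show ?thesis
    by (simp add: inversion_piola_def inversion_jac_def inner_diff_left mult.assoc)
qed

lemma inversion_jac_has_derivative:
  fixes x :: "real ^ 'n::finite"
  assumes "x \<noteq> 0"
  shows "(inversion_jac has_derivative
      (\<lambda>h. - 2 * real CARD('n) * inversion_jac x * (x \<bullet> h) / (x \<bullet> x))) (at x)"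
proof -
  \<comment> \<open>A successor form of the dimension keeps truncated subtraction out of the power
    rule.\<close>
  obtain m where m: "CARD('n) = Suc m" by (metis gr0_implies_Suc zero_less_card_finite)
  have "((\<lambda>x. inverse (x \<bullet> x) ^ Suc m) has_derivative
      (\<lambda>h. real (Suc m) * (- (inverse (x \<bullet> x) * (x \<bullet> h + h \<bullet> x) * inverse (x \<bullet> x))) * inverse (x \<bullet> x) ^ m)) (at x)"
    using assms by (auto intro!: derivative_eq_intros simp del: power_Suc)
  moreover have "real (Suc m) * (- (inverse (x \<bullet> x) * (x \<bullet> h + h \<bullet> x) * inverse (x \<bullet> x))) * inverse (x \<bullet> x) ^ m
      = - 2 * real (Suc m) * inverse (x \<bullet> x) ^ Suc m * (x \<bullet> h) / (x \<bullet> x)" for h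
    by (simp add: inner_commute divide_inverse algebra_simps)
  ultimately show ?thesis
    by (simp add: inversion_jac_def[abs_def] m del: power_Suc)
qed

text \<open>The product rule gives two parts. The field applied to the gradient of the pullback
  undoes the chain rule and leaves the derivative of \<open>\<phi>\<close> along \<open>b\<close>;
  the other part carries the divergence of the field, which is 0.\<close>

lemma divergence_inversion_piola:
  fixes x b :: "real ^ 'n::finite"
  assumes x: "x \<noteq> 0" and \<phi>: "(\<phi> has_derivative \<phi>') (at (inversion x))"
  shows "(\<Sum>i\<in>Basis. frechet_derivative (\<lambda>x. inversion_piola b x \<bullet> i * \<phi> (inversion x)) (at x) i)
    = inversion_jac x * \<phi>' b"
proof -
  let ?J = "inversion_jac x" and ?N = "real CARD('n)"
  define P where "P = (x \<bullet> x) *\<^sub>R b - (2 * (x \<bullet> b)) *\<^sub>R x"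
  define \<psi>' where "\<psi>' h = \<phi>' (inversion_deriv x h)" for h
  have \<psi>: "((\<lambda>x. \<phi> (inversion x)) has_derivative \<psi>') (at x)"
    unfolding \<psi>'_def by (rule has_derivative_compose[OF inversion_has_derivative[OF x] \<phi>])
  have "x \<bullet> x \<noteq> 0" using x by simp
  have eq: "inversion_piola b y \<bullet> i = inversion_jac y * ((y \<bullet> y) * (b \<bullet> i) - 2 * (y \<bullet> b) * (y \<bullet> i))" for y i
    by (simp add: inversion_piola_def inner_diff_left)
  \<comment> \<open>Differentiating the bracket along \<open>i\<close> produces
    \<open>2 * (x \<bullet> i) * (b \<bullet> i)\<close> twice with opposite signs; only
    \<open>- 2 * (x \<bullet> b)\<close> survives, as \<open>i \<bullet> i = 1\<close>.\<close>
  have "frechet_derivative (\<lambda>x. inversion_piola b x \<bullet> i * \<phi> (inversion x)) (at x) i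
      = ?J * ((P \<bullet> i) * \<psi>' i) + \<phi> (inversion x) *
        (- 2 * (x \<bullet> b) * ?J + (- 2 * ?N * ?J / (x \<bullet> x)) * ((x \<bullet> i) * (P \<bullet> i)))"
    if "i \<in> Basis" for i
  proof -
    have "((\<lambda>x. inversion_piola b x \<bullet> i * \<phi> (inversion x)) has_derivative
      (\<lambda>h. inversion_piola b x \<bullet> i * \<psi>' h +
        (?J * ((x \<bullet> h + h \<bullet> x) * (b \<bullet> i) - (2 * (x \<bullet> b) * (h \<bullet> i) + 2 * (h \<bullet> b) * (x \<bullet> i)))
        + (- 2 * ?N * ?J * (x \<bullet> h) / (x \<bullet> x)) * ((x \<bullet> x) * (b \<bullet> i) - 2 * (x \<bullet> b) * (x \<bullet> i)))
        * \<phi> (inversion x))) (at x)"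
      unfolding eq
      by (rule has_derivative_mult[OF has_derivative_mult[OF inversion_jac_has_derivative[OF x]] \<psi>])
        (auto intro!: derivative_eq_intros)
    note frechet_derivative_at[OF this, symmetric, THEN fun_cong, of i]
    also have "inversion_piola b x \<bullet> i = ?J * (P \<bullet> i)"
      by (simp add: eq P_def inner_diff_left)
    finally show ?thesis
      using that \<open>x \<bullet> x \<noteq> 0\<close>
      by (simp add: P_def inner_diff_left inner_commute[of i x] inner_commute[of i b] field_simps)
  qed
  then have "(\<Sum>i\<in>Basis. frechet_derivative (\<lambda>x. inversion_piola b x \<bullet> i * \<phi> (inversion x)) (at x) i)
      = (\<Sum>i\<in>Basis. ?J * ((P \<bullet> i) * \<psi>' i) + \<phi> (inversion x) *
        (- 2 * (x \<bullet> b) * ?J + (- 2 * ?N * ?J / (x \<bullet> x)) * ((x \<bullet> i) * (P \<bullet> i))))"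
    by (rule sum.cong[OF refl])
  also have "\<dots> = ?J * (\<Sum>i\<in>Basis. (P \<bullet> i) * \<psi>' i) + \<phi> (inversion x) *
        (?N * (- 2 * (x \<bullet> b) * ?J) + (- 2 * ?N * ?J / (x \<bullet> x)) * (\<Sum>i\<in>Basis. (x \<bullet> i) * (P \<bullet> i)))"
  proof -
    have "(\<Sum>i\<in>(Basis :: (real ^ 'n) set). a * F i + q * (A + C * G i))
        = a * (\<Sum>i\<in>Basis. F i) + q * (?N * A + C * (\<Sum>i\<in>Basis. G i))" for F G and a q A C :: real
      by (simp add: sum.distrib sum_distrib_left algebra_simps)
    then show ?thesis .
  qed
  also have "(\<Sum>i\<in>Basis. (x \<bullet> i) * (P \<bullet> i)) = x \<bullet> P"
    by (rule euclidean_inner[symmetric])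
  \<comment> \<open>With this value the two terms multiplying \<open>\<phi> (inversion x)\<close>
    are opposite, so the field has no divergence.\<close>
  also have "x \<bullet> P = - (x \<bullet> x) * (x \<bullet> b)"
    by (simp add: P_def inner_diff_right)
  also have "(\<Sum>i\<in>Basis. (P \<bullet> i) * \<psi>' i) = \<psi>' P"
  proof -
    have "linear \<psi>'" using \<psi> by (rule has_derivative_linear)
    then have "\<psi>' (\<Sum>i\<in>Basis. (P \<bullet> i) *\<^sub>R i) = (\<Sum>i\<in>Basis. (P \<bullet> i) * \<psi>' i)"
      by (simp add: linear_sum linear_cmul)
    then show ?thesis by (simp add: euclidean_representation)
  qed
  also have "\<psi>' P = \<phi>' b"
    using inversion_deriv_inverse[of "inversion x" b] x
    by (simp add: \<psi>'_def P_def inversion_deriv_at_inversion)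
  finally show ?thesis using \<open>x \<bullet> x \<noteq> 0\<close> by simp
qed

section \<open>The chain rule for weak gradients\<close>

lemma weak_gradient_cong:
  assumes "open \<Omega>" "weak_gradient \<Omega> u g" "\<And>x. x \<in> \<Omega> \<Longrightarrow> u x = u' x" "\<And>x. x \<in> \<Omega> \<Longrightarrow> g x = g' x"
  shows "weak_gradient \<Omega> u' g'"
proof -
  have "\<Omega> \<in> sets lebesgue" using assms(1) by (simp add: borel_open)
  then have "(LINT x:\<Omega>|lebesgue. u' x * F x) = (LINT x:\<Omega>|lebesgue. u x * F x)"
    "(LINT x:\<Omega>|lebesgue. (g' x \<bullet> b) * F x) = (LINT x:\<Omega>|lebesgue. (g x \<bullet> b) * F x)" for F b
    using assms(3,4) by (auto intro!: set_lebesgue_integral_cong)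
  then show ?thesis
    using assms(2-4) L1_loc_cong[of \<Omega> u u'] L1_loc_cong[of \<Omega> g g']
    by (simp add: weak_gradient_def)
qed

text \<open>The change of variables introduces the Jacobian, a continuous weight away from 0, which
  preserves local integrability.\<close>

lemma L1_loc_inversion:
  fixes f :: "real ^ 'n::finite \<Rightarrow> real"
  assumes "f \<in> L1_loc \<Omega>" "0 \<notin> \<Omega>"
  shows "(\<lambda>y. f (inversion y)) \<in> L1_loc (inversion ` \<Omega>)"
  unfolding L1_loc_def
proof (intro CollectI allI impI)
  fix K assume K: "compact K \<and> K \<subseteq> inversion ` \<Omega>"
  then have K0: "0 \<notin> K" using assms(2) by auto
  have "inversion ` K \<subseteq> \<Omega>"
    using K image_mono[of K "inversion ` \<Omega>" inversion] by simp
  moreover have "compact (inversion ` K)"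
    using K K0 by (simp add: compact_inversion_image)
  moreover have "continuous_on \<Omega> inversion_jac"
    unfolding inversion_jac_def[abs_def] using assms(2) by (auto intro!: continuous_intros)
  ultimately have "(\<lambda>x. inversion_jac x * f x) absolutely_integrable_on (inversion ` K)"
    using L1_loc_mult_continuous[OF assms(1)] by (auto simp: L1_loc_def)
  then show "(\<lambda>y. f (inversion y)) absolutely_integrable_on K"
    using K0 absolutely_integrable_on_inversion_image[of "inversion ` K" "\<lambda>y. f (inversion y)"]
    by simp
qed

lemma set_integral_sum:
  fixes f :: "'i \<Rightarrow> 'a \<Rightarrow> real"
  assumes "\<And>i. i \<in> I \<Longrightarrow> set_integrable M A (f i)"
  shows "(LINT x:A|M. (\<Sum>i\<in>I. f i x)) = (\<Sum>i\<in>I. LINT x:A|M. f i x)"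
  using assms unfolding set_lebesgue_integral_def set_integrable_def scaleR_sum_right
  by (rule Bochner_Integration.integral_sum)

text \<open>The chain rule in weak form: a test of the pulled-back function in direction
  \<open>b\<close> becomes a test of \<open>u\<close> against the divergence of a smooth compactly
  supported field, to which the weak gradient of \<open>u\<close> applies componentwise.\<close>

lemma weak_gradient_inversion:
  fixes u :: "real ^ 'n::finite \<Rightarrow> real"
  assumes \<Omega>: "open \<Omega>" "0 \<notin> \<Omega>" and wg: "weak_gradient \<Omega> u g"
  shows "weak_gradient (inversion ` \<Omega>) (\<lambda>y. u (inversion y))
    (\<lambda>y. inversion_deriv y (g (inversion y)))"
  unfolding weak_gradient_def
proof (intro conjI ballI)
  have u: "u \<in> L1_loc \<Omega>" and g: "g \<in> L1_loc \<Omega>"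
    using wg by (simp_all add: weak_gradient_def)
  then have gi: "(\<lambda>x. g x \<bullet> i) \<in> L1_loc \<Omega>" if "i \<in> Basis" for i
    using that L1_loc_componentwise by blast
  have \<Omega>_leb: "\<Omega> \<in> sets lebesgue" using \<Omega>(1) by (simp add: borel_open)
  show "(\<lambda>y. u (inversion y)) \<in> L1_loc (inversion ` \<Omega>)"
    using u \<Omega>(2) by (rule L1_loc_inversion)
  show "(\<lambda>y. inversion_deriv y (g (inversion y))) \<in> L1_loc (inversion ` \<Omega>)"
    unfolding L1_loc_componentwise[of "\<lambda>y. inversion_deriv y (g (inversion y))"]
  proof
    fix b :: "real ^ 'n"
    \<comment> \<open>By symmetry of the derivative, each component of the candidate gradient is a
      combination of components of \<open>g\<close> with continuous coefficients.\<close>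
    have "(\<lambda>y. \<Sum>i\<in>Basis. (inversion_deriv y b \<bullet> i) * (g (inversion y) \<bullet> i)) \<in> L1_loc (inversion ` \<Omega>)"
      using \<Omega>(2) gi unfolding inversion_deriv_def
      by (intro L1_loc_sum L1_loc_mult_continuous L1_loc_inversion continuous_intros)
        (auto intro: L1_loc_inversion)
    moreover have "inversion_deriv y a \<bullet> b = (\<Sum>i\<in>Basis. (inversion_deriv y b \<bullet> i) * (a \<bullet> i))"
      for y a :: "real ^ 'n"
      by (simp add: inversion_deriv_adjoint mult.commute euclidean_inner[of a "inversion_deriv y b"])
    ultimately show "(\<lambda>y. inversion_deriv y (g (inversion y)) \<bullet> b) \<in> L1_loc (inversion ` \<Omega>)"
      by simp
  qed
  fix \<phi> and b :: "real ^ 'n"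
  assume \<phi>: "\<phi> \<in> test_functions (inversion ` \<Omega>)" and b: "b \<in> Basis"
  \<comment> \<open>The components of the Piola field times the pulled-back test function; each one
    is tested in its own direction \<open>i\<close>.\<close>
  define \<eta> where "\<eta> i x = inversion_piola b x \<bullet> i * \<phi> (inversion x)" for i x
  have \<eta>: "\<eta> i \<in> test_functions \<Omega>" for i
    unfolding \<eta>_def using \<Omega> \<phi> by (intro test_functions_inversion Ck_on_inversion_piola)
  have x0: "x \<noteq> 0" if "x \<in> \<Omega>" for x using that \<Omega>(2) by auto
  have div: "(\<Sum>i\<in>Basis. frechet_derivative (\<eta> i) (at x) i)
      = inversion_jac x * frechet_derivative \<phi> (at (inversion x)) b" if "x \<in> \<Omega>" for x
    unfolding \<eta>_def
  proof (rule divergence_inversion_piola[OF x0[OF that]])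
    have "Ck_on (Suc 0) (inversion ` \<Omega>) \<phi>"
      using \<phi> by (simp add: test_functions_def)
    then show "(\<phi> has_derivative frechet_derivative \<phi> (at (inversion x))) (at (inversion x))"
      using Ck_on_Suc_has_derivative open_inversion_image[OF \<Omega>] that by blast
  qed
  have "(LINT y:inversion ` \<Omega>|lebesgue. u (inversion y) * frechet_derivative \<phi> (at y) b)
      = (LINT x:\<Omega>|lebesgue. inversion_jac x * (u x * frechet_derivative \<phi> (at (inversion x)) b))"
    by (simp add: LINT_inversion_image \<Omega>)
  also have "\<dots> = (LINT x:\<Omega>|lebesgue. (\<Sum>i\<in>Basis. u x * frechet_derivative (\<eta> i) (at x) i))"
    by (intro set_lebesgue_integral_cong \<Omega>_leb) (auto simp: div algebra_simps simp flip: sum_distrib_left)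
  also have "\<dots> = (\<Sum>i\<in>Basis. LINT x:\<Omega>|lebesgue. u x * frechet_derivative (\<eta> i) (at x) i)"
    using absolutely_integrable_L1_loc_deriv_test[OF u \<eta>] by (simp add: set_integral_sum)
  also have "\<dots> = (\<Sum>i\<in>Basis. - (LINT x:\<Omega>|lebesgue. (g x \<bullet> i) * \<eta> i x))"
    using wg \<eta> by (auto simp: weak_gradient_def)
  also have "\<dots> = - (LINT x:\<Omega>|lebesgue. (\<Sum>i\<in>Basis. (g x \<bullet> i) * \<eta> i x))"
    using absolutely_integrable_L1_loc_test[OF gi \<eta>] by (simp add: set_integral_sum sum_negf)
  also have "(LINT x:\<Omega>|lebesgue. (\<Sum>i\<in>Basis. (g x \<bullet> i) * \<eta> i x)) =
      (LINT x:\<Omega>|lebesgue. inversion_jac x * (inversion_deriv (inversion x) (g x) \<bullet> b * \<phi> (inversion x)))"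
  proof (intro set_lebesgue_integral_cong \<Omega>_leb allI impI)
    fix x assume "x \<in> \<Omega>"
    have "(\<Sum>i\<in>Basis. (g x \<bullet> i) * \<eta> i x) = (\<Sum>i\<in>Basis. (g x \<bullet> i) * (inversion_piola b x \<bullet> i)) * \<phi> (inversion x)"
      by (simp add: \<eta>_def sum_distrib_right mult.assoc)
    also have "(\<Sum>i\<in>Basis. (g x \<bullet> i) * (inversion_piola b x \<bullet> i)) = g x \<bullet> inversion_piola b x"
      by (rule euclidean_inner[symmetric])
    also have "\<dots> = inversion_jac x * (inversion_deriv (inversion x) (g x) \<bullet> b)"
      unfolding inversion_deriv_adjoint
      by (simp add: inversion_piola_def inversion_deriv_at_inversion x0[OF \<open>x \<in> \<Omega>\<close>])
    finally show "(\<Sum>i\<in>Basis. (g x \<bullet> i) * \<eta> i x) =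
      inversion_jac x * (inversion_deriv (inversion x) (g x) \<bullet> b * \<phi> (inversion x))" by simp
  qed
  also have "\<dots> = (LINT y:inversion ` \<Omega>|lebesgue. (inversion_deriv y (g (inversion y)) \<bullet> b) * \<phi> y)"
    by (simp add: LINT_inversion_image \<Omega>)
  finally show "(LINT y:inversion ` \<Omega>|lebesgue. u (inversion y) * frechet_derivative \<phi> (at y) b) =
      - (LINT y:inversion ` \<Omega>|lebesgue. (inversion_deriv y (g (inversion y)) \<bullet> b) * \<phi> y)" .
qed

section \<open>Weighted Sobolev spaces under the inversion\<close>

lemma inversion_jac_eq_powr:
  fixes x :: "real ^ 'n::finite"
  assumes "x \<noteq> 0"
  shows "inversion_jac x = norm x powr (- 2 * real CARD('n))"
proof -
  have "norm x powr (2 * real CARD('n)) = (norm x powr 2) powr real CARD('n)"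
    by (simp only: powr_powr)
  also have "\<dots> = (x \<bullet> x) ^ CARD('n)"
    using assms by (simp add: powr_realpow power2_norm_eq_inner)
  finally show ?thesis
    by (simp add: inversion_jac_def powr_minus power_inverse)
qed

lemma norm_inversion_powr: "norm (inversion x) powr a = norm x powr (- a)"
  by (simp add: powr_minus inverse_powr)

text \<open>After the change of variables the square of \<open>h\<close> is dominated by
  \<open>C\<close> times the square of \<open>f\<close>. The bound is asked for only where
  \<open>f\<close> is nonzero, so that a compact support can supply it.\<close>

lemma L2_inversion:
  fixes f h c :: "real ^ 'n::finite \<Rightarrow> real"
  assumes S: "S \<in> sets lebesgue" "0 \<notin> S" and f: "f \<in> L2 S"
    and c: "continuous_on (inversion ` S) c"
    and h: "\<And>y. y \<in> inversion ` S \<Longrightarrow> h y = c y * f (inversion y)"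
    and C: "AE x in lebesgue. x \<in> S \<longrightarrow> f x \<noteq> 0 \<longrightarrow> inversion_jac x * (c (inversion x))\<^sup>2 \<le> C"
  shows "h \<in> L2 (inversion ` S)"
proof -
  have fm: "f \<in> borel_measurable (lebesgue_on S)" and f2: "(\<lambda>x. (f x)\<^sup>2) absolutely_integrable_on S"
    using f by (auto simp: L2_def)
  have cm: "c \<in> borel_measurable (lebesgue_on (inversion ` S))"
    using c by (intro continuous_imp_measurable_on_sets_lebesgue lebesgue_inversion_image S)
  have "(\<lambda>y. c y * f (inversion y)) \<in> borel_measurable (lebesgue_on (inversion ` S))"
    using cm measurable_inversion[OF fm S] by (rule borel_measurable_times)
  then have hm: "h \<in> borel_measurable (lebesgue_on (inversion ` S))"
    using h by (subst measurable_lebesgue_cong[where g = "\<lambda>y. c y * f (inversion y)"])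
  have jm: "inversion_jac \<in> borel_measurable (lebesgue_on S)"
    unfolding inversion_jac_def[abs_def] using S
    by (intro continuous_imp_measurable_on_sets_lebesgue) (auto intro!: continuous_intros)
  have cm': "(\<lambda>x. c (inversion x)) \<in> borel_measurable (lebesgue_on S)"
    using measurable_inversion[OF cm lebesgue_inversion_image[OF S]] S by simp
  have "integrable (lebesgue_on S) (\<lambda>x. C * (f x)\<^sup>2)"
    using f2 S by (simp add: integrable_restrict_space set_integrable_def)
  then have "integrable (lebesgue_on S) (\<lambda>x. inversion_jac x * (c (inversion x) * f x)\<^sup>2)"
  proof (rule Bochner_Integration.integrable_bound)
    show "(\<lambda>x. inversion_jac x * (c (inversion x) * f x)\<^sup>2) \<in> borel_measurable (lebesgue_on S)"
      using jm cm' fm by (intro borel_measurable_times borel_measurable_power)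
    have bound: "norm (inversion_jac x * (c (inversion x) * f x)\<^sup>2) \<le> norm (C * (f x)\<^sup>2)"
      if "f x \<noteq> 0 \<longrightarrow> inversion_jac x * (c (inversion x))\<^sup>2 \<le> C" for x
    proof (cases "f x = 0")
      case False
      have j: "0 \<le> inversion_jac x" by (simp add: inversion_jac_def)
      have "inversion_jac x * (c (inversion x))\<^sup>2 \<le> \<bar>C\<bar>"
        using that False by linarith
      then have "inversion_jac x * (c (inversion x))\<^sup>2 * (f x)\<^sup>2 \<le> \<bar>C\<bar> * (f x)\<^sup>2"
        by (intro mult_right_mono) auto
      then show ?thesis
        using j by (simp add: power_mult_distrib abs_mult mult.assoc)
    qed simp
    have "AE x in lebesgue. x \<in> S \<longrightarrow>
        norm (inversion_jac x * (c (inversion x) * f x)\<^sup>2) \<le> norm (C * (f x)\<^sup>2)"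
      using C by (rule eventually_mono) (use bound in blast)
    then show "AE x in lebesgue_on S. norm (inversion_jac x * (c (inversion x) * f x)\<^sup>2) \<le> norm (C * (f x)\<^sup>2)"
      using S by (subst AE_restrict_space_iff) auto
  qed
  then have "(\<lambda>x. inversion_jac x * (c (inversion x) * f x)\<^sup>2) absolutely_integrable_on S"
    using S by (simp add: integrable_restrict_space set_integrable_def)
  then have "(\<lambda>y. (c y * f (inversion y))\<^sup>2) absolutely_integrable_on inversion ` S"
    by (simp add: absolutely_integrable_on_inversion_image[OF S(2)])
  then have "(\<lambda>y. (h y)\<^sup>2) absolutely_integrable_on inversion ` S"
    using h by (subst set_integrable_cong[OF refl refl, of _ _ "\<lambda>y. (c y * f (inversion y))\<^sup>2"]) auto
  then show ?thesis using hm by (simp add: L2_def)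
qed

text \<open>The derivative contributes \<open>|y|\<^sup>-\<^sup>2\<close>, and the relation between
  the exponents leaves exactly the factor \<open>|y|\<^sup>-\<^sup>N\<close>, whose square cancels
  the Jacobian. Hence \<open>C = 1\<close> on any set avoiding 0.\<close>

lemma L2_gradient_inversion:
  fixes g :: "real ^ 'n::finite \<Rightarrow> real ^ 'n"
  assumes S: "S \<in> sets lebesgue" "0 \<notin> S"
    and \<mu>: "\<mu> + \<mu>' = 4 - 2 * real CARD('n)"
    and g: "(\<lambda>x. norm x powr (\<mu> / 2) * norm (g x)) \<in> L2 S"
  shows "(\<lambda>y. norm y powr (\<mu>' / 2) * norm (inversion_deriv y (g (inversion y)))) \<in> L2 (inversion ` S)"
proof (rule L2_inversion[OF S g, where c = "\<lambda>y. norm y powr (- real CARD('n))" and C = 1])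
  have 0: "y \<noteq> 0" if "y \<in> inversion ` S" for y using S that by auto
  show "continuous_on (inversion ` S) (\<lambda>y. norm y powr (- real CARD('n)))"
    using S by (auto intro!: continuous_intros)
  fix y assume "y \<in> inversion ` S"
  then have "y \<noteq> 0" using 0 by blast
  have "norm y powr (\<mu>' / 2) / (norm y)\<^sup>2 = norm y powr (\<mu>' / 2 - 2)"
    using \<open>y \<noteq> 0\<close> by (simp add: powr_diff)
  also have "\<mu>' / 2 - 2 = - real CARD('n) + - (\<mu> / 2)" using \<mu> by simp
  also have "norm y powr (- real CARD('n) + - (\<mu> / 2)) = norm y powr (- real CARD('n)) * norm (inversion y) powr (\<mu> / 2)"
    unfolding norm_inversion_powr powr_add ..
  finally have *: "norm y powr (\<mu>' / 2) / (norm y)\<^sup>2 =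
      norm y powr (- real CARD('n)) * norm (inversion y) powr (\<mu> / 2)" .
  show "norm y powr (\<mu>' / 2) * norm (inversion_deriv y (g (inversion y))) =
      norm y powr (- real CARD('n)) * (norm (inversion y) powr (\<mu> / 2) * norm (g (inversion y)))"
    by (simp only: norm_inversion_deriv times_divide_eq_right times_divide_eq_left[symmetric] * mult.assoc)
next
  have "inversion_jac x * (norm (inversion x) powr (- real CARD('n)))\<^sup>2 = 1" if "x \<noteq> 0" for x :: "real ^ 'n"
    unfolding norm_inversion_powr inversion_jac_eq_powr[OF that] power2_eq_square
      powr_add[symmetric] using that by simp
  then show "AE x in lebesgue. x \<in> S \<longrightarrow> norm x powr (\<mu> / 2) * norm (g x) \<noteq> 0 \<longrightarrow>
      inversion_jac x * (norm (inversion x) powr (- real CARD('n)))\<^sup>2 \<le> 1"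
    using S(2) by (intro AE_I2 impI) (metis order_refl)
qed

text \<open>Without a derivative the remaining factor is \<open>|y|\<^sup>2\<^sup>-\<^sup>N\<close>,
  and \<open>?w x\<close> amounts to \<open>|x|\<^sup>-\<^sup>4\<close>. This is unbounded near 0,
  so the bound is taken on a compact set outside which \<open>u\<close> vanishes.\<close>

lemma L2_value_inversion:
  fixes u :: "real ^ 'n::finite \<Rightarrow> real"
  assumes S: "S \<in> sets lebesgue" "0 \<notin> S"
    and \<mu>: "\<mu> + \<mu>' = 4 - 2 * real CARD('n)"
    and u: "(\<lambda>x. norm x powr (\<mu> / 2) * u x) \<in> L2 S"
    and K: "compact K" "0 \<notin> K" "AE x in lebesgue. x \<in> S - K \<longrightarrow> u x = 0"
  shows "(\<lambda>y. norm y powr (\<mu>' / 2) * u (inversion y)) \<in> L2 (inversion ` S)"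
proof -
  let ?c = "\<lambda>y :: real ^ 'n. norm y powr (2 - real CARD('n))"
  let ?w = "\<lambda>x. inversion_jac x * (?c (inversion x))\<^sup>2"
  have "continuous_on K ?w"
    unfolding inversion_jac_def norm_inversion_powr using K(2) by (auto intro!: continuous_intros)
  then have "bounded (?w ` K)"
    using K(1) compact_continuous_image compact_imp_bounded by blast
  then obtain C where "\<forall>x\<in>?w ` K. \<bar>x\<bar> \<le> C"
    unfolding bounded_real by blast
  then have C: "?w x \<le> C" if "x \<in> K" for x
    using that by (simp add: abs_le_iff)
  show ?thesis
  proof (rule L2_inversion[OF S u, where c = ?c and C = C])
    show "continuous_on (inversion ` S) ?c"
      using S by (auto intro!: continuous_intros)
    fix y assume "y \<in> inversion ` S"
    have "\<mu>' / 2 = (2 - real CARD('n)) + - (\<mu> / 2)" using \<mu> by simp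
    then have "norm y powr (\<mu>' / 2) = ?c y * norm (inversion y) powr (\<mu> / 2)"
      by (simp only: norm_inversion_powr powr_add)
    then show "norm y powr (\<mu>' / 2) * u (inversion y) =
        ?c y * (norm (inversion y) powr (\<mu> / 2) * u (inversion y))"
      by simp
  next
    show "AE x in lebesgue. x \<in> S \<longrightarrow> norm x powr (\<mu> / 2) * u x \<noteq> 0 \<longrightarrow> ?w x \<le> C"
      using K(3)
    proof (rule eventually_mono)
      fix x assume "x \<in> S - K \<longrightarrow> u x = 0"
      then show "x \<in> S \<longrightarrow> norm x powr (\<mu> / 2) * u x \<noteq> 0 \<longrightarrow> ?w x \<le> C"
        using C[of x] by auto
    qed
  qed
qed

section \<open>Transport of the function spaces\<close>

lemma H1_loc_inversion:
  fixes u :: "real ^ 'n::finite \<Rightarrow> real"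
  assumes \<Omega>: "open \<Omega>" "0 \<notin> \<Omega>" and \<mu>: "\<mu> + \<mu>' = 4 - 2 * real CARD('n)"
    and u: "u \<in> H1_loc \<mu> \<Omega>"
  shows "(\<lambda>y. u (inversion y)) \<in> H1_loc \<mu>' (inversion ` \<Omega>)"
proof -
  obtain g where g: "weak_gradient \<Omega> u g"
    and L2: "\<And>K. compact K \<Longrightarrow> K \<subseteq> \<Omega> \<Longrightarrow> (\<lambda>x. norm x powr (\<mu> / 2) * u x) \<in> L2 K"
      "\<And>K. compact K \<Longrightarrow> K \<subseteq> \<Omega> \<Longrightarrow> (\<lambda>x. norm x powr (\<mu> / 2) * norm (g x)) \<in> L2 K"
    using u unfolding H1_loc_def by blast
  have "(\<lambda>y. norm y powr (\<mu>' / 2) * u (inversion y)) \<in> L2 K \<and>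
      (\<lambda>y. norm y powr (\<mu>' / 2) * norm (inversion_deriv y (g (inversion y)))) \<in> L2 K"
    if K: "compact K" "K \<subseteq> inversion ` \<Omega>" for K
  proof -
    have K0: "0 \<notin> K" "0 \<notin> inversion ` K" using K \<Omega> by auto
    have K': "compact (inversion ` K)" "inversion ` K \<subseteq> \<Omega>"
      using K image_mono[OF K(2), of inversion] K0 by (auto simp: compact_inversion_image)
    then have leb: "inversion ` K \<in> sets lebesgue"
      by (simp add: lmeasurable_compact fmeasurableD)
    \<comment> \<open>The image of \<open>K\<close> serves both as the domain and as the compact
      support, so the vanishing condition is empty.\<close>
    show ?thesis
      using L2_value_inversion[OF leb K0(2) \<mu> L2(1)[OF K'] K'(1) K0(2)]
        L2_gradient_inversion[OF leb K0(2) \<mu> L2(2)[OF K']] by simp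
  qed
  then show ?thesis
    using weak_gradient_inversion[OF \<Omega> g] unfolding H1_loc_def by blast
qed

lemma H1_c_inversion:
  fixes u :: "real ^ 'n::finite \<Rightarrow> real"
  assumes \<Omega>: "open \<Omega>" "0 \<notin> \<Omega>" and \<mu>: "\<mu> + \<mu>' = 4 - 2 * real CARD('n)"
    and u: "u \<in> H1_c \<mu> \<Omega>"
  shows "(\<lambda>y. u (inversion y)) \<in> H1_c \<mu>' (inversion ` \<Omega>)"
proof -
  obtain K where K: "compact K" "K \<subseteq> \<Omega>" "AE x in lebesgue. x \<in> \<Omega> - K \<longrightarrow> u x = 0"
    using u unfolding H1_c_def by blast
  obtain g where g: "weak_gradient \<Omega> u g"
    and L2: "(\<lambda>x. norm x powr (\<mu> / 2) * u x) \<in> L2 \<Omega>"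
      "(\<lambda>x. norm x powr (\<mu> / 2) * norm (g x)) \<in> L2 \<Omega>"
    using u unfolding H1_c_def H1_def by blast
  have leb: "\<Omega> \<in> sets lebesgue" using \<Omega> by (simp add: borel_open)
  have K0: "0 \<notin> K" using K \<Omega> by auto
  have "(\<lambda>y. u (inversion y)) \<in> H1 \<mu>' (inversion ` \<Omega>)"
    using weak_gradient_inversion[OF \<Omega> g] L2_value_inversion[OF leb \<Omega>(2) \<mu> L2(1) K(1) K0 K(3)]
      L2_gradient_inversion[OF leb \<Omega>(2) \<mu> L2(2)]
    unfolding H1_def by blast
  moreover have "AE y in lebesgue. y \<in> inversion ` \<Omega> - inversion ` K \<longrightarrow> u (inversion y) = 0"
    using AE_inversion[OF K(3)] \<Omega>(2) by (simp add: image_set_diff[OF inj_inversion])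
  moreover have "compact (inversion ` K)" "inversion ` K \<subseteq> inversion ` \<Omega>"
    using K K0 by (auto simp: compact_inversion_image)
  ultimately show ?thesis unfolding H1_c_def by blast
qed

lemma Linfty_loc_inversion:
  fixes u :: "real ^ 'n::finite \<Rightarrow> real"
  assumes \<Omega>: "open \<Omega>" "0 \<notin> \<Omega>" and u: "u \<in> Linfty_loc \<Omega>"
  shows "(\<lambda>y. u (inversion y)) \<in> Linfty_loc (inversion ` \<Omega>)"
proof -
  have leb: "\<Omega> \<in> sets lebesgue" using \<Omega> by (simp add: borel_open)
  have "\<exists>C. AE y in lebesgue. y \<in> K \<longrightarrow> \<bar>u (inversion y)\<bar> \<le> C" if K: "compact K" "K \<subseteq> inversion ` \<Omega>" for K
  proof -
    have K0: "0 \<notin> K" "0 \<notin> inversion ` K" using K \<Omega> by auto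
    have "compact (inversion ` K)" "inversion ` K \<subseteq> \<Omega>"
      using K image_mono[OF K(2), of inversion] K0 by (auto simp: compact_inversion_image)
    then obtain C where "AE x in lebesgue. x \<in> inversion ` K \<longrightarrow> \<bar>u x\<bar> \<le> C"
      using u unfolding Linfty_loc_def by blast
    from AE_inversion[OF this K0(2)] show ?thesis by auto
  qed
  then show ?thesis
    using measurable_inversion[OF _ leb \<Omega>(2)] u by (auto simp: Linfty_loc_def)
qed

section \<open>Independence of the values outside the domain\<close>

lemma L2_cong:
  assumes "\<And>x. x \<in> S \<Longrightarrow> f x = g x"
  shows "f \<in> L2 S \<longleftrightarrow> g \<in> L2 S"
proof -
  have "(\<lambda>x. (f x)\<^sup>2) absolutely_integrable_on S \<longleftrightarrow> (\<lambda>x. (g x)\<^sup>2) absolutely_integrable_on S"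
    using assms by (intro set_integrable_cong) auto
  then show ?thesis
    using measurable_lebesgue_cong[of S f g borel] assms by (simp add: L2_def)
qed

lemma H1_loc_cong:
  assumes "open \<Omega>" "\<And>x. x \<in> \<Omega> \<Longrightarrow> u x = u' x" "u \<in> H1_loc \<mu> \<Omega>"
  shows "u' \<in> H1_loc \<mu> \<Omega>"
proof -
  obtain g where g: "weak_gradient \<Omega> u g"
    and L2: "\<And>K. compact K \<Longrightarrow> K \<subseteq> \<Omega> \<Longrightarrow> (\<lambda>x. norm x powr (\<mu> / 2) * u x) \<in> L2 K"
      "\<And>K. compact K \<Longrightarrow> K \<subseteq> \<Omega> \<Longrightarrow> (\<lambda>x. norm x powr (\<mu> / 2) * norm (g x)) \<in> L2 K"
    using assms(3) unfolding H1_loc_def by blast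
  have L2': "(\<lambda>x. norm x powr (\<mu> / 2) * u' x) \<in> L2 K" if "compact K" "K \<subseteq> \<Omega>" for K
  proof -
    have "norm x powr (\<mu> / 2) * u x = norm x powr (\<mu> / 2) * u' x" if "x \<in> K" for x
      using assms(2) \<open>K \<subseteq> \<Omega>\<close> that by auto
    from L2_cong[of K, OF this] show ?thesis using L2(1)[OF that] by simp
  qed
  show ?thesis
    unfolding H1_loc_def
    using weak_gradient_cong[OF assms(1) g assms(2) refl] L2' L2(2)
    by (intro CollectI exI[of _ g]) simp
qed

lemma Linfty_loc_cong:
  assumes "\<And>x. x \<in> \<Omega> \<Longrightarrow> u x = u' x" "u \<in> Linfty_loc \<Omega>"
  shows "u' \<in> Linfty_loc \<Omega>"
proof -
  have "(AE x in lebesgue. x \<in> K \<longrightarrow> \<bar>u' x\<bar> \<le> C) \<longleftrightarrow> (AE x in lebesgue. x \<in> K \<longrightarrow> \<bar>u x\<bar> \<le> C)"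
    if "K \<subseteq> \<Omega>" for K C
    using that assms(1) by (intro AE_cong) (auto simp: subset_iff)
  then show ?thesis
    using assms(2) measurable_lebesgue_cong[of \<Omega> u u' borel] assms(1) by (auto simp: Linfty_loc_def)
qed

section \<open>Transport of solutions and of stability\<close>

text \<open>The factor \<open>|x|\<^sup>-\<^sup>4\<close> comes from the inner product of two transported gradients.\<close>

lemma inversion_weight:
  fixes x :: "real ^ 'n::finite"
  assumes "x \<noteq> 0" and "\<mu> + \<mu>' = 4 - 2 * real CARD('n)"
  shows "inversion_jac x * norm (inversion x) powr \<mu>' = norm x powr \<mu> / norm x ^ 4"
proof -
  have "inversion_jac x * norm (inversion x) powr \<mu>' = norm x powr (- 2 * real CARD('n) + - \<mu>')"
    unfolding norm_inversion_powr inversion_jac_eq_powr[OF assms(1)] powr_add ..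
  also have "- 2 * real CARD('n) + - \<mu>' = \<mu> - real 4" using assms(2) by simp
  also have "norm x powr (\<mu> - real 4) = norm x powr \<mu> / norm x ^ 4"
    unfolding powr_diff using assms(1) powr_realpow[of "norm x" 4] by simp
  finally show ?thesis .
qed

text \<open>The zero-order term has no gradients, so the Jacobian alone fixes the sum of its
  exponents.\<close>

lemma inversion_weight':
  fixes x :: "real ^ 'n::finite"
  assumes "x \<noteq> 0" and "\<nu> + \<nu>' = - 2 * real CARD('n)"
  shows "inversion_jac x * norm (inversion x) powr \<nu>' = norm x powr \<nu>"
proof -
  have "inversion_jac x * norm (inversion x) powr \<nu>' = norm x powr (- 2 * real CARD('n) + - \<nu>')"
    unfolding norm_inversion_powr inversion_jac_eq_powr[OF assms(1)] powr_add ..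
  also have "- 2 * real CARD('n) + - \<nu>' = \<nu>" using assms(2) by simp
  finally show ?thesis .
qed

lemma integral_transport_inversion:
  fixes F F' :: "real ^ 'n::finite \<Rightarrow> real"
  assumes "open \<Omega>" "0 \<notin> \<Omega>" "\<And>x. x \<in> \<Omega> \<Longrightarrow> inversion_jac x * F' (inversion x) = F x"
  shows "F' absolutely_integrable_on inversion ` \<Omega> \<longleftrightarrow> F absolutely_integrable_on \<Omega>"
    and "(LINT y:inversion ` \<Omega>|lebesgue. F' y) = (LINT x:\<Omega>|lebesgue. F x)"
proof -
  show "F' absolutely_integrable_on inversion ` \<Omega> \<longleftrightarrow> F absolutely_integrable_on \<Omega>"
    unfolding absolutely_integrable_on_inversion_image[OF assms(2)]
    using assms(3) by (intro set_integrable_cong) auto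
  show "(LINT y:inversion ` \<Omega>|lebesgue. F' y) = (LINT x:\<Omega>|lebesgue. F x)"
    unfolding LINT_inversion_image[OF assms(2)]
    using assms(1,3) by (intro set_lebesgue_integral_cong) (auto simp: borel_open)
qed

text \<open>The chain rule run backwards, as the inversion is an involution. An arbitrary weak
  gradient of \<open>z\<close> yields one of \<open>v\<close>, as the quantifiers over gradients in
  the definitions require.\<close>

lemma weak_gradient_pullback:
  fixes v z :: "real ^ 'n::finite \<Rightarrow> real"
  assumes "open \<Omega>" "0 \<notin> \<Omega>" "\<And>x. x \<in> \<Omega> \<Longrightarrow> z (inversion x) = v x"
    and "weak_gradient (inversion ` \<Omega>) z Dz"
  shows "weak_gradient \<Omega> v (\<lambda>x. inversion_deriv x (Dz (inversion x)))"
  using weak_gradient_cong[OF assms(1) _ assms(3)]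
    weak_gradient_inversion[OF open_inversion_image[OF assms(1,2)] _ assms(4)] assms(2)
  by simp

lemma test_space_pullback:
  fixes \<phi> :: "real ^ 'n::finite \<Rightarrow> real"
  assumes "open \<Omega>" "0 \<notin> \<Omega>" "\<mu> + \<mu>' = 4 - 2 * real CARD('n)"
    and "\<phi> \<in> H1_c \<mu>' (inversion ` \<Omega>) \<inter> Linfty_loc (inversion ` \<Omega>)"
  shows "(\<lambda>x. \<phi> (inversion x)) \<in> H1_c \<mu> \<Omega> \<inter> Linfty_loc \<Omega>"
  using H1_c_inversion[of "inversion ` \<Omega>" \<mu>' \<mu> \<phi>] Linfty_loc_inversion[of "inversion ` \<Omega>" \<phi>]
    assms open_inversion_image[OF assms(1,2)]
  by (simp add: add.commute)

text \<open>The equation for \<open>v\<close> is tested with the pullback of \<open>\<phi>\<close>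
  and with the pullbacks of the given gradients; its integrand is then the transported one times the
  Jacobian.\<close>

lemma is_solution_inversion:
  fixes v z :: "real ^ 'n::finite \<Rightarrow> real"
  assumes \<Omega>: "open \<Omega>" "0 \<notin> \<Omega>"
    and \<mu>: "\<mu> + \<mu>' = 4 - 2 * real CARD('n)" and \<nu>: "\<nu> + \<nu>' = - 2 * real CARD('n)"
    and z: "\<And>x. x \<in> \<Omega> \<Longrightarrow> z (inversion x) = v x"
    and v: "is_solution \<mu> \<nu> p \<Omega> v"
  shows "is_solution \<mu>' \<nu>' p (inversion ` \<Omega>) z"
  unfolding is_solution_def
proof (intro conjI ballI allI impI)
  have z': "v (inversion y) = z y" if "y \<in> inversion ` \<Omega>" for y
    using z that by auto
  have "v \<in> H1_loc \<mu> \<Omega>" "v \<in> Linfty_loc \<Omega>" using v by (auto simp: is_solution_def)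
  then show "z \<in> H1_loc \<mu>' (inversion ` \<Omega>) \<inter> Linfty_loc (inversion ` \<Omega>)"
    using H1_loc_cong[OF open_inversion_image[OF \<Omega>], of "\<lambda>y. v (inversion y)" z \<mu>']
      Linfty_loc_cong[of "inversion ` \<Omega>" "\<lambda>y. v (inversion y)" z]
      H1_loc_inversion[OF \<Omega> \<mu>] Linfty_loc_inversion[OF \<Omega>] z' by blast
  fix \<phi> Dz D\<phi>
  assume \<phi>: "\<phi> \<in> H1_c \<mu>' (inversion ` \<Omega>) \<inter> Linfty_loc (inversion ` \<Omega>)"
    and Dz: "weak_gradient (inversion ` \<Omega>) z Dz"
    and D\<phi>: "weak_gradient (inversion ` \<Omega>) \<phi> D\<phi>"
  let ?F = "\<lambda>x. norm x powr \<mu> * (inversion_deriv x (Dz (inversion x)) \<bullet> inversion_deriv x (D\<phi> (inversion x)))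
    - norm x powr \<nu> * \<bar>v x\<bar> powr (p - 1) * v x * \<phi> (inversion x)"
  let ?F' = "\<lambda>y. norm y powr \<mu>' * (Dz y \<bullet> D\<phi> y) - norm y powr \<nu>' * \<bar>z y\<bar> powr (p - 1) * z y * \<phi> y"
  have F: "?F absolutely_integrable_on \<Omega> \<and> (LINT x:\<Omega>|lebesgue. ?F x) = 0"
    using v test_space_pullback[OF \<Omega> \<mu> \<phi>] weak_gradient_pullback[OF \<Omega> z Dz]
      weak_gradient_pullback[OF \<Omega> refl D\<phi>]
    unfolding is_solution_def by blast
  have eq: "inversion_jac x * ?F' (inversion x) = ?F x" if "x \<in> \<Omega>" for x
  proof -
    have x: "x \<noteq> 0" using that \<Omega> by auto
    have "inversion_jac x * ?F' (inversion x) =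
      (inversion_jac x * norm (inversion x) powr \<mu>') * (Dz (inversion x) \<bullet> D\<phi> (inversion x))
      - (inversion_jac x * norm (inversion x) powr \<nu>') * \<bar>v x\<bar> powr (p - 1) * v x * \<phi> (inversion x)"
      using z[OF that] by (simp only: right_diff_distrib mult.assoc)
    then show ?thesis
      by (simp only: inversion_weight[OF x \<mu>] inversion_weight'[OF x \<nu>] inner_inversion_deriv) simp
  qed
  show "?F' absolutely_integrable_on inversion ` \<Omega>"
    using integral_transport_inversion(1)[OF \<Omega> eq] F by blast
  show "(LINT y:inversion ` \<Omega>|lebesgue. ?F' y) = 0"
    using integral_transport_inversion(2)[OF \<Omega> eq] F by simp
qed

text \<open>The same pullback turns one quadratic form into the other with equal value, so its sign
  is kept. Since the domains and exponents enter symmetrically, the lemma also serves for the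
  converse.\<close>

lemma is_stable_inversion:
  fixes v z :: "real ^ 'n::finite \<Rightarrow> real"
  assumes \<Omega>: "open \<Omega>" "0 \<notin> \<Omega>"
    and \<mu>: "\<mu> + \<mu>' = 4 - 2 * real CARD('n)" and \<nu>: "\<nu> + \<nu>' = - 2 * real CARD('n)"
    and z: "\<And>x. x \<in> \<Omega> \<Longrightarrow> z (inversion x) = v x"
    and v: "is_stable \<mu> \<nu> p \<Omega> v"
  shows "is_stable \<mu>' \<nu>' p (inversion ` \<Omega>) z"
  unfolding is_stable_def
proof (intro conjI ballI allI impI)
  fix \<psi> D\<psi>
  assume \<psi>: "\<psi> \<in> H1_c \<mu>' (inversion ` \<Omega>) \<inter> Linfty_loc (inversion ` \<Omega>)"
    and D\<psi>: "weak_gradient (inversion ` \<Omega>) \<psi> D\<psi>"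
  let ?F = "\<lambda>x. norm x powr \<mu> * (norm (inversion_deriv x (D\<psi> (inversion x))))\<^sup>2
    - p * norm x powr \<nu> * \<bar>v x\<bar> powr (p - 1) * (\<psi> (inversion x))\<^sup>2"
  let ?F' = "\<lambda>y. norm y powr \<mu>' * (norm (D\<psi> y))\<^sup>2 - p * norm y powr \<nu>' * \<bar>z y\<bar> powr (p - 1) * (\<psi> y)\<^sup>2"
  have F: "?F absolutely_integrable_on \<Omega> \<and> (LINT x:\<Omega>|lebesgue. ?F x) \<ge> 0"
    by (rule v[unfolded is_stable_def, rule_format, OF test_space_pullback[OF \<Omega> \<mu> \<psi>]
          weak_gradient_pullback[OF \<Omega> refl D\<psi>]])
  have eq: "inversion_jac x * ?F' (inversion x) = ?F x" if "x \<in> \<Omega>" for x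
  proof -
    have x: "x \<noteq> 0" using that \<Omega> by auto
    have "inversion_jac x * ?F' (inversion x) =
      (inversion_jac x * norm (inversion x) powr \<mu>') * (norm (D\<psi> (inversion x)))\<^sup>2
      - p * (inversion_jac x * norm (inversion x) powr \<nu>') * \<bar>v x\<bar> powr (p - 1) * (\<psi> (inversion x))\<^sup>2"
      using z[OF that] by (simp only: right_diff_distrib mult.assoc mult.left_commute[of _ p])
    then show ?thesis
      by (simp only: inversion_weight[OF x \<mu>] inversion_weight'[OF x \<nu>] power2_norm_eq_inner inner_inversion_deriv) simp
  qed
  show "?F' absolutely_integrable_on inversion ` \<Omega>"
    using integral_transport_inversion(1)[OF \<Omega> eq] F by blast
  show "(LINT y:inversion ` \<Omega>|lebesgue. ?F' y) \<ge> 0"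
    using integral_transport_inversion(2)[OF \<Omega> eq] F by simp
qed

section \<open>The punctured ball and the conclusion\<close>

lemma inversion_image_punctured_ball:
  assumes "R > 0"
  shows "inversion ` (ball 0 R - {0 :: 'a::euclidean_space}) = - closure (ball 0 (1 / R))"
proof -
  \<comment> \<open>At \<open>y = 0\<close> both sides fail: the origin is fixed and removed, and
    \<open>1 / R\<close> is positive.\<close>
  have "inversion y \<in> ball 0 R - {0} \<longleftrightarrow> 1 / R < norm y" for y :: 'a
    using assms by (cases "y = 0") (auto simp: field_simps inverse_eq_divide)
  then have "inversion ` (ball 0 R - {0 :: 'a}) = {y. 1 / R < norm y}"
    unfolding inversion_image_eq vimage_def by (simp only:)
  then show ?thesis
    using assms by (simp add: Compl_eq not_le)
qed

theorem proposition1p8: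
  fixes v z :: "real ^ 'n \<Rightarrow> real" and p \<theta> l \<theta>' l' R :: real
  assumes "CARD('n) \<ge> 2" and "p > 1" and "R > 0"
    and "is_solution \<theta> l p (ball 0 R - {0}) v"
    and "\<And>x. x \<in> ball 0 R - {0} \<Longrightarrow> z (x /\<^sub>R (norm x)\<^sup>2) = v x"
    and "\<theta>' = 4 - 2 * real CARD('n) - \<theta>" and "l' = - 2 * real CARD('n) - l"
  shows "is_stable \<theta> l p (ball 0 R - {0}) v \<longleftrightarrow>
    is_solution \<theta>' l' p (- closure (ball 0 (1 / R))) z \<and>
    is_stable \<theta>' l' p (- closure (ball 0 (1 / R))) z"
proof -
  define \<Omega> :: "(real ^ 'n) set" where "\<Omega> = ball 0 R - {0}"
  have \<Omega>: "open \<Omega>" "0 \<notin> \<Omega>" by (auto simp: \<Omega>_def open_delete)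
  have img: "- closure (ball 0 (1 / R)) = inversion ` \<Omega>"
    unfolding \<Omega>_def by (rule inversion_image_punctured_ball[OF assms(3), symmetric])
  have z: "z (inversion x) = v x" if "x \<in> \<Omega>" for x
    using assms(5) that by (simp add: \<Omega>_def inversion_def)
  have v: "v (inversion y) = z y" if "y \<in> inversion ` \<Omega>" for y
    using z that by auto
  have \<theta>: "\<theta> + \<theta>' = 4 - 2 * real CARD('n)" "\<theta>' + \<theta> = 4 - 2 * real CARD('n)"
    and l: "l + l' = - 2 * real CARD('n)" "l' + l = - 2 * real CARD('n)"
    using assms(6,7) by simp_all
  \<comment> \<open>The equation for \<open>z\<close> follows from that for \<open>v\<close> alone,
    so the equivalence is really one between the two stability conditions.\<close>
  have "is_solution \<theta>' l' p (inversion ` \<Omega>) z"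
    using assms(4) by (intro is_solution_inversion[OF \<Omega> \<theta>(1) l(1), of z v]) (simp_all add: z \<Omega>_def[symmetric])
  moreover have "is_stable \<theta>' l' p (inversion ` \<Omega>) z" if "is_stable \<theta> l p \<Omega> v"
    using z that by (rule is_stable_inversion[OF \<Omega> \<theta>(1) l(1), of z v])
  \<comment> \<open>Inverting the exterior domain returns the punctured ball, so the converse is the
    same lemma with \<open>v\<close> and \<open>z\<close> exchanged.\<close>
  moreover have "is_stable \<theta> l p \<Omega> v" if "is_stable \<theta>' l' p (inversion ` \<Omega>) z"
    using is_stable_inversion[OF open_inversion_image[OF \<Omega>] _ \<theta>(2) l(2), of v z] v that \<Omega>(2) by simp
  ultimately show ?thesis
    unfolding img \<Omega>_def[symmetric] by blast
qed

end
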